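(* Let $N^4(c)$ be a $4$-dimensional space form of constant sectional curvature $c\neq 0$, and let $\varphi:M^2\hookrightarrow N^4(c)$ be an isometric immersion of a surface which is CMC and biconservative. Then $M^2$ is PMC.
   Context: Everything is smooth. $g=\langle\,,\rangle$ is the induced metric on $M^2$, $B$ is the second fundamental form, $H=\frac12\,\mathrm{trace}\,B$ is the mean curvature vector field, and $A_H$ is the shape operator in the direction of $H$, i.e. $\langle A_H X,Y\rangle=\langle B(X,Y),H\rangle$. $\nabla^\perp$ is the normal connection. CMC means that $|H|$ is constant. PMC (parallel mean curvature) means $\nabla^\perp H=0$ on $M^2$. The stress-bienergy tensor is $S_2(X,Y)=-2|H|^2\langle X,Y\rangle+4\langle A_H X,Y\rangle$, and the immersion is called biconservative if $\mathrm{div}\,S_2=0$. For surfaces in a space of constant sectional curvature this is equivalent to $2\,\mathrm{trace}\,A_{\nabla^\perp_{(\cdot)}H}(\cdot)+\mathrm{grad}\,|H|^2=0$, where $\mathrm{trace}\,A_{\nabla^\perp_{(\cdot)}H}(\cdot)=\sum_i A_{\nabla^\perp_{e_i}H}(e_i)$ for a local orthonormal frame $\{e_i\}$ on $M^2$ and $A_\xi$ is the shape operator in the normal direction $\xi$. *)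

theory Defs
  imports "HOL-Analysis.Analysis"
begin

section \<open>Smooth functions on open subsets of Euclidean space\<close>

abbreviation der :: "('a::real_normed_vector \<Rightarrow> 'b::real_normed_vector) \<Rightarrow> 'a \<Rightarrow> 'a \<Rightarrow> 'b" where
  "der F x v \<equiv> frechet_derivative F (at x) v"

text \<open>\<open>Ck_on k S F\<close> and \<open>smooth_on S F\<close> are intended for open \<open>S\<close> only.\<close>

primrec Ck_on :: "nat \<Rightarrow> (real^'n) set \<Rightarrow> (real^'n \<Rightarrow> 'b::real_normed_vector) \<Rightarrow> bool" where
  "Ck_on 0 S F \<longleftrightarrow> continuous_on S F"
| "Ck_on (Suc k) S F \<longleftrightarrow>
     (\<forall>x\<in>S. F differentiable (at x)) \<and> (\<forall>i. Ck_on k S (\<lambda>x. der F x (axis i 1)))"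

definition smooth_on :: "(real^'n) set \<Rightarrow> (real^'n \<Rightarrow> 'b::real_normed_vector) \<Rightarrow> bool" where
  "smooth_on S F \<longleftrightarrow> (\<forall>k. Ck_on k S F)"

section \<open>Riemannian geometry in coordinates\<close>

text \<open>A Riemannian metric on an open subset of \<open>\<real>\<^sup>n\<close> is given by its matrix of coefficients
  \<open>g :: real^'n \<Rightarrow> real^'n^'n\<close>; the inner product of the tangent vectors \<open>v\<close>, \<open>w\<close> at \<open>x\<close> is
  \<open>ip (g x) v w\<close>.  Throughout, a vector \<open>v :: real^'n\<close> also stands for the vector field with the
  constant components \<open>v\<close>; these fields commute.\<close>

definition ip :: "real^'n^'n \<Rightarrow> real^'n \<Rightarrow> real^'n \<Rightarrow> real" where
  "ip A v w = v \<bullet> (A *v w)"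

definition riemannian_metric_on :: "(real^'n) set \<Rightarrow> (real^'n \<Rightarrow> real^'n^'n) \<Rightarrow> bool" where
  "riemannian_metric_on S g \<longleftrightarrow> smooth_on S g \<and>
     (\<forall>x\<in>S. (\<forall>v w. ip (g x) v w = ip (g x) w v) \<and> (\<forall>v. v \<noteq> 0 \<longrightarrow> ip (g x) v v > 0))"

text \<open>The Levi-Civita connection on constant fields, \<open>\<nabla>\<^sub>v w = \<Gamma>(v, w)\<close>.  The Koszul formula reads
  \<open>2 \<langle>\<Gamma>(v, w), e\<^sub>l\<rangle> = v\<langle>w, e\<^sub>l\<rangle> + w\<langle>v, e\<^sub>l\<rangle> - e\<^sub>l\<langle>v, w\<rangle>\<close>, and \<open>e\<^sub>l = axis l 1\<close>.\<close>

definition christoffel :: "(real^'n \<Rightarrow> real^'n^'n) \<Rightarrow> real^'n \<Rightarrow> real^'n \<Rightarrow> real^'n \<Rightarrow> real^'n" where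
  "christoffel g x v w = matrix_inv (g x) *v (\<chi> l. (1/2) *
     (der (\<lambda>y. ip (g y) w (axis l 1)) x v + der (\<lambda>y. ip (g y) v (axis l 1)) x w
        - der (\<lambda>y. ip (g y) v w) x (axis l 1)))"

text \<open>\<open>R(u, v)w = \<nabla>\<^sub>u \<nabla>\<^sub>v w - \<nabla>\<^sub>v \<nabla>\<^sub>u w - \<nabla>\<^bsub>[u,v]\<^esub> w\<close> for constant fields.\<close>

definition curvature ::
    "(real^'n \<Rightarrow> real^'n^'n) \<Rightarrow> real^'n \<Rightarrow> real^'n \<Rightarrow> real^'n \<Rightarrow> real^'n \<Rightarrow> real^'n" where
  "curvature g x u v w =
     der (\<lambda>y. christoffel g y v w) x u + christoffel g x u (christoffel g x v w)
     - (der (\<lambda>y. christoffel g y u w) x v + christoffel g x v (christoffel g x u w))"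

definition sectional_curvature ::
    "(real^'n \<Rightarrow> real^'n^'n) \<Rightarrow> real^'n \<Rightarrow> real^'n \<Rightarrow> real^'n \<Rightarrow> real" where
  "sectional_curvature g x v w =
     ip (g x) (curvature g x v w w) v / (ip (g x) v v * ip (g x) w w - (ip (g x) v w)\<^sup>2)"

text \<open>Divergence of a field \<open>S\<close> of bilinear forms:
  \<open>(div S)(Y) = \<Sum>\<^sub>a\<^sub>b g\<^sup>a\<^sup>b (\<nabla>\<^bsub>e\<^sub>a\<^esub> S)(e\<^sub>b, Y)\<close>.\<close>

definition cov_deriv_form ::
    "(real^'n \<Rightarrow> real^'n^'n) \<Rightarrow> (real^'n \<Rightarrow> real^'n \<Rightarrow> real^'n \<Rightarrow> real)
       \<Rightarrow> real^'n \<Rightarrow> real^'n \<Rightarrow> real^'n \<Rightarrow> real^'n \<Rightarrow> real" where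
  "cov_deriv_form g S x X Y Z =
     der (\<lambda>y. S y Y Z) x X - S x (christoffel g x X Y) Z - S x Y (christoffel g x X Z)"

definition divergence ::
    "(real^'n \<Rightarrow> real^'n^'n) \<Rightarrow> (real^'n \<Rightarrow> real^'n \<Rightarrow> real^'n \<Rightarrow> real) \<Rightarrow> real^'n \<Rightarrow> real^'n \<Rightarrow> real" where
  "divergence g S x Y =
     (\<Sum>a\<in>UNIV. \<Sum>b\<in>UNIV. matrix_inv (g x) $ a $ b * cov_deriv_form g S x (axis a 1) (axis b 1) Y)"

section \<open>Isometric immersions in coordinates\<close>

text \<open>Below, \<open>f\<close> is the coordinate expression of a map, \<open>g\<close> the metric on the source and \<open>h\<close> the
  metric on the target.  A vector field along \<open>f\<close> is a function \<open>V\<close> of the source coordinates.\<close>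

definition cov_along ::
    "(real^'n \<Rightarrow> real^'n^'n) \<Rightarrow> (real^'m \<Rightarrow> real^'n) \<Rightarrow> (real^'m \<Rightarrow> real^'n)
       \<Rightarrow> real^'m \<Rightarrow> real^'m \<Rightarrow> real^'n" where
  "cov_along h f V u X = der V u X + christoffel h (f u) (der f u X) (V u)"

text \<open>\<open>B(X, Y) = \<nabla>\<^sup>N\<^sub>X df(Y) - df(\<nabla>\<^sub>X Y)\<close>.\<close>

definition second_ff ::
    "(real^'m \<Rightarrow> real^'m^'m) \<Rightarrow> (real^'n \<Rightarrow> real^'n^'n) \<Rightarrow> (real^'m \<Rightarrow> real^'n)
       \<Rightarrow> real^'m \<Rightarrow> real^'m \<Rightarrow> real^'m \<Rightarrow> real^'n" where
  "second_ff g h f u X Y = cov_along h f (\<lambda>u'. der f u' Y) u X - der f u (christoffel g u X Y)"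

text \<open>The factor \<open>1/2\<close> is the inverse of the dimension of the surface.\<close>

definition mean_curvature ::
    "(real^2 \<Rightarrow> real^2^2) \<Rightarrow> (real^'n \<Rightarrow> real^'n^'n) \<Rightarrow> (real^2 \<Rightarrow> real^'n) \<Rightarrow> real^2 \<Rightarrow> real^'n" where
  "mean_curvature g h f u = (1/2) *\<^sub>R
     (\<Sum>a\<in>UNIV. \<Sum>b\<in>UNIV. (matrix_inv (g u) $ a $ b) *\<^sub>R second_ff g h f u (axis a 1) (axis b 1))"

definition shape_operator ::
    "(real^'m \<Rightarrow> real^'m^'m) \<Rightarrow> (real^'n \<Rightarrow> real^'n^'n) \<Rightarrow> (real^'m \<Rightarrow> real^'n)
       \<Rightarrow> real^'m \<Rightarrow> real^'n \<Rightarrow> real^'m \<Rightarrow> real^'m" where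
  "shape_operator g h f u \<xi> X =
     (THE Z. \<forall>Y. ip (g u) Z Y = ip (h (f u)) (second_ff g h f u X Y) \<xi>)"

text \<open>Orthogonal projection onto the normal space.  The subtracted term is \<open>df(W)\<close>, where
  \<open>\<langle>W, e\<^sub>a\<rangle> = \<langle>V, df(e\<^sub>a)\<rangle>\<close>; for an isometric \<open>f\<close> it is the tangential part of \<open>V\<close>.\<close>

definition normal_part ::
    "(real^'m \<Rightarrow> real^'m^'m) \<Rightarrow> (real^'n \<Rightarrow> real^'n^'n) \<Rightarrow> (real^'m \<Rightarrow> real^'n)
       \<Rightarrow> real^'m \<Rightarrow> real^'n \<Rightarrow> real^'n" where
  "normal_part g h f u V =
     V - der f u (matrix_inv (g u) *v (\<chi> a. ip (h (f u)) V (der f u (axis a 1))))"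

definition normal_connection ::
    "(real^'m \<Rightarrow> real^'m^'m) \<Rightarrow> (real^'n \<Rightarrow> real^'n^'n) \<Rightarrow> (real^'m \<Rightarrow> real^'n)
       \<Rightarrow> (real^'m \<Rightarrow> real^'n) \<Rightarrow> real^'m \<Rightarrow> real^'m \<Rightarrow> real^'n" where
  "normal_connection g h f \<xi> u X = normal_part g h f u (cov_along h f \<xi> u X)"

definition norm_H ::
    "(real^2 \<Rightarrow> real^2^2) \<Rightarrow> (real^'n \<Rightarrow> real^'n^'n) \<Rightarrow> (real^2 \<Rightarrow> real^'n) \<Rightarrow> real^2 \<Rightarrow> real" where
  "norm_H g h f u = sqrt (ip (h (f u)) (mean_curvature g h f u) (mean_curvature g h f u))"

definition stress_bienergy ::
    "(real^2 \<Rightarrow> real^2^2) \<Rightarrow> (real^'n \<Rightarrow> real^'n^'n) \<Rightarrow> (real^2 \<Rightarrow> real^'n)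
       \<Rightarrow> real^2 \<Rightarrow> real^2 \<Rightarrow> real^2 \<Rightarrow> real" where
  "stress_bienergy g h f u X Y =
     - 2 * (norm_H g h f u)\<^sup>2 * ip (g u) X Y
     + 4 * ip (g u) (shape_operator g h f u (mean_curvature g h f u) X) Y"

section \<open>Riemannian manifolds and maps between them\<close>

text \<open>A chart \<open>(U, x)\<close> consists of a domain and a coordinate map.  A Riemannian metric is stored as
  its coefficient matrices in the charts of the atlas, as functions of the coordinates.\<close>

type_synonym ('a, 'n) chart = "'a set \<times> ('a \<Rightarrow> real^'n)"

record ('a, 'n::finite) riem_mfd =
  mfd_top :: "'a topology"
  atlas :: "('a, 'n::finite) chart set"
  coeffs :: "('a, 'n::finite) chart \<Rightarrow> real^'n \<Rightarrow> real^'n^'n"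

definition overlap :: "('a, 'n::finite) chart \<Rightarrow> ('a, 'n::finite) chart \<Rightarrow> (real^'n) set" where
  "overlap a b = snd a ` (fst a \<inter> fst b)"

definition transition :: "('a, 'n::finite) chart \<Rightarrow> ('a, 'n::finite) chart \<Rightarrow> real^'n \<Rightarrow> real^'n" where
  "transition a b = snd b \<circ> inv_into (fst a) (snd a)"

definition smooth_manifold :: "('a, 'n::finite) riem_mfd \<Rightarrow> bool" where
  "smooth_manifold M \<longleftrightarrow>
     Hausdorff_space (mfd_top M) \<and> second_countable (mfd_top M) \<and>
     (\<Union>a\<in>atlas M. fst a) = topspace (mfd_top M) \<and>
     (\<forall>a\<in>atlas M. openin (mfd_top M) (fst a) \<and> open (snd a ` fst a) \<and>
        homeomorphic_map (subtopology (mfd_top M) (fst a)) (top_of_set (snd a ` fst a)) (snd a)) \<and>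
     (\<forall>a\<in>atlas M. \<forall>b\<in>atlas M. smooth_on (overlap a b) (transition a b))"

definition riemannian_manifold :: "('a, 'n::finite) riem_mfd \<Rightarrow> bool" where
  "riemannian_manifold M \<longleftrightarrow>
     smooth_manifold M \<and>
     (\<forall>a\<in>atlas M. riemannian_metric_on (snd a ` fst a) (coeffs M a)) \<and>
     (\<forall>a\<in>atlas M. \<forall>b\<in>atlas M. \<forall>u\<in>overlap a b. \<forall>v w.
        ip (coeffs M a u) v w =
        ip (coeffs M b (transition a b u)) (der (transition a b) u v) (der (transition a b) u w))"

text \<open>Completeness and simple connectedness are not required.\<close>

definition space_form :: "real \<Rightarrow> ('a, 'n::finite) riem_mfd \<Rightarrow> bool" where
  "space_form c N \<longleftrightarrow>
     riemannian_manifold N \<and>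
     (\<forall>a\<in>atlas N. \<forall>x\<in>snd a ` fst a. \<forall>v w. v \<noteq> w \<and> independent {v, w} \<longrightarrow>
        sectional_curvature (coeffs N a) x v w = c)"

definition rep_dom :: "('a \<Rightarrow> 'b) \<Rightarrow> ('a, 'm::finite) chart \<Rightarrow> ('b, 'n::finite) chart \<Rightarrow> (real^'m) set" where
  "rep_dom \<phi> a b = snd a ` (fst a \<inter> \<phi> -` fst b)"

definition local_rep ::
    "('a \<Rightarrow> 'b) \<Rightarrow> ('a, 'm::finite) chart \<Rightarrow> ('b, 'n::finite) chart \<Rightarrow> real^'m \<Rightarrow> real^'n" where
  "local_rep \<phi> a b = snd b \<circ> \<phi> \<circ> inv_into (fst a) (snd a)"

text \<open>\<open>P g h f u\<close> holds for all coordinate expressions \<open>g\<close>, \<open>h\<close>, \<open>f\<close> of the two metrics and the map,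
  at all coordinates \<open>u\<close> of points of the source.  The properties \<open>P\<close> used below are invariant under
  a change of charts.\<close>

definition in_all_charts ::
    "('a, 'm::finite) riem_mfd \<Rightarrow> ('b, 'n::finite) riem_mfd \<Rightarrow> ('a \<Rightarrow> 'b) \<Rightarrow>
     ((real^'m \<Rightarrow> real^'m^'m) \<Rightarrow> (real^'n \<Rightarrow> real^'n^'n) \<Rightarrow> (real^'m \<Rightarrow> real^'n) \<Rightarrow> real^'m \<Rightarrow> bool)
     \<Rightarrow> bool" where
  "in_all_charts M N \<phi> P \<longleftrightarrow>
     (\<forall>a\<in>atlas M. \<forall>b\<in>atlas N. \<forall>u\<in>rep_dom \<phi> a b.
        P (coeffs M a) (coeffs N b) (local_rep \<phi> a b) u)"

definition smooth_map :: "('a, 'm::finite) riem_mfd \<Rightarrow> ('b, 'n::finite) riem_mfd \<Rightarrow> ('a \<Rightarrow> 'b) \<Rightarrow> bool" where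
  "smooth_map M N \<phi> \<longleftrightarrow>
     continuous_map (mfd_top M) (mfd_top N) \<phi> \<and>
     (\<forall>a\<in>atlas M. \<forall>b\<in>atlas N. smooth_on (rep_dom \<phi> a b) (local_rep \<phi> a b))"

definition isometric_immersion ::
    "('a, 'm::finite) riem_mfd \<Rightarrow> ('b, 'n::finite) riem_mfd \<Rightarrow> ('a \<Rightarrow> 'b) \<Rightarrow> bool" where
  "isometric_immersion M N \<phi> \<longleftrightarrow>
     smooth_map M N \<phi> \<and>
     in_all_charts M N \<phi> (\<lambda>g h f u. inj (der f u)) \<and>
     in_all_charts M N \<phi> (\<lambda>g h f u. \<forall>X Y. ip (h (f u)) (der f u X) (der f u Y) = ip (g u) X Y)"

definition CMC :: "('a, 2) riem_mfd \<Rightarrow> ('b, 'n::finite) riem_mfd \<Rightarrow> ('a \<Rightarrow> 'b) \<Rightarrow> bool" where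
  "CMC M N \<phi> \<longleftrightarrow> (\<exists>k. in_all_charts M N \<phi> (\<lambda>g h f u. norm_H g h f u = k))"

definition PMC :: "('a, 2) riem_mfd \<Rightarrow> ('b, 'n::finite) riem_mfd \<Rightarrow> ('a \<Rightarrow> 'b) \<Rightarrow> bool" where
  "PMC M N \<phi> \<longleftrightarrow> in_all_charts M N \<phi>
     (\<lambda>g h f u. \<forall>X. normal_connection g h f (mean_curvature g h f) u X = 0)"

definition biconservative :: "('a, 2) riem_mfd \<Rightarrow> ('b, 'n::finite) riem_mfd \<Rightarrow> ('a \<Rightarrow> 'b) \<Rightarrow> bool" where
  "biconservative M N \<phi> \<longleftrightarrow> in_all_charts M N \<phi>
     (\<lambda>g h f u. \<forall>Y. divergence g (stress_bienergy g h f) u Y = 0)"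

end

(* Suppose the normal derivative of H is not zero near a point; then k = |H| > 0.  Let E3 = H / k and let
   E4 complete it to an orthonormal frame of the normal bundle, with connection form w(X) = <D_X E3, E4>.
   By Codazzi, div S_2 = 0 says that the dual vector of w lies in the kernel of A_4, which is traceless,
   so A_4 = 0.  The curvature of the target annihilates tangential pairs applied to normal fields.
   Applied to E4 this gives dw = 0 and w(Y) A_3 X = w(X) A_3 Y, so A_3 has rank one, with eigenvalue 2k
   in the direction t of w.  Applied to E3 it gives D_X T = 2k <t, X> E3 for T = df(t).  Hence the
   curvature of the target also annihilates T, which forces c = 0. *)
theory Submission
  imports Defs
begin

section \<open>Derivatives in coordinates\<close>

text \<open>What shapes the argument is that c = 0 is a genuine exception: the cylinder over a curve
  in Euclidean 3-space with constant positive curvature and nowhere vanishing torsion is CMC and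
  biconservative in Euclidean 4-space, but not PMC. The Codazzi and Ricci equations, in which c
  drops out, therefore cannot give a contradiction by themselves; they force the surface to look
  like such a cylinder. Indeed the equations obtained for T, E3, E4 are the Frenet equations of a
  curve with curvature 2k and torsion w(t), with no change in the direction q orthogonal to t. What
  separates c = 0 from the other cases is the ambient curvature of the pair (t, q) applied to T,
  which equals -c df(q). The frame is differentiated twice, so it has to be smooth on an open set.
  For this reason E4 is the normalised normal derivative of H in a fixed coordinate direction X0; it
  is orthogonal to H because |H| is constant. This derivative is nonzero on an open set, so one
  point where H fails to be parallel already yields a frame around it.\<close>

lemma der_eqI: "(F has_derivative F') (at x) \<Longrightarrow> der F x v = F' v"
  using frechet_derivative_at by metis

lemma has_derivative_der: "F differentiable (at x) \<Longrightarrow> (F has_derivative der F x) (at x)"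
  by (simp add: frechet_derivative_works)

lemma differentiable_cong_open:
  assumes "open S" "x \<in> S" "\<And>y. y \<in> S \<Longrightarrow> F y = G y"
  shows "F differentiable (at x) \<longleftrightarrow> G differentiable (at x)"
  using has_derivative_transform_within_open[OF _ assms(1,2)] assms(3)
  unfolding differentiable_def by metis

text \<open>\<open>frechet_derivative\<close> is a choice operator, so functions that agree near
  \<open>x\<close> get the same value even where neither is differentiable: their sets of
  derivatives at \<open>x\<close> coincide, hence so do the choices.\<close>

lemma der_cong_open:
  assumes "open S" "x \<in> S" "\<And>y. y \<in> S \<Longrightarrow> F y = G y"
  shows "der F x = der G x"
proof -
  have "(F has_derivative D) (at x) \<longleftrightarrow> (G has_derivative D) (at x)" for D
    using has_derivative_transform_within_open[OF _ assms(1,2)] assms(3) by metis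
  then show ?thesis
    unfolding frechet_derivative_def by simp
qed

lemma axis_expansion: "(v :: real^'n) = (\<Sum>i\<in>UNIV. v $ i *\<^sub>R axis i 1)"
  using basis_expansion[of v] by (simp add: scalar_mult_eq_scaleR)

lemma linear_axis_expansion:
  assumes "linear L"
  shows "L (v :: real^'n) = (\<Sum>i\<in>UNIV. v $ i *\<^sub>R L (axis i 1))"
  by (subst axis_expansion[of v]) (simp add: linear_sum[OF assms] linear_cmul[OF assms])

lemma der_axis_expansion:
  assumes "F differentiable (at x)"
  shows "der F x v = (\<Sum>i\<in>UNIV. v $ i *\<^sub>R der F x (axis i 1))"
  by (rule linear_axis_expansion) (rule linear_frechet_derivative[OF assms])

section \<open>Calculus of smooth functions\<close>

lemma Ck_on_subset: "Ck_on k S F \<Longrightarrow> T \<subseteq> S \<Longrightarrow> Ck_on k T F"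
  by (induction k arbitrary: F) (auto intro: continuous_on_subset)

lemma Ck_on_cong:
  assumes "open S"
  shows "(\<And>y. y \<in> S \<Longrightarrow> F y = G y) \<Longrightarrow> Ck_on k S F \<longleftrightarrow> Ck_on k S G"
proof (induction k arbitrary: F G)
  case 0
  then show ?case by (simp cong: continuous_on_cong)
next
  case (Suc k)
  have "Ck_on k S (\<lambda>x. der F x (axis i 1)) \<longleftrightarrow> Ck_on k S (\<lambda>x. der G x (axis i 1))" for i
    by (rule Suc.IH) (metis der_cong_open[OF assms] Suc.prems)
  then show ?case
    using differentiable_cong_open[OF assms, of _ F G] Suc.prems by simp
qed

text \<open>The common induction step of most closure rules that follow: any explicit formula for
  the derivative may be used, and it has to be of class \<open>Ck_on k\<close> in the coordinate
  directions. \<open>Ck_on_cong\<close> replaces \<open>der\<close> by the formula on the open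
  set.\<close>

lemma Ck_on_SucI:
  assumes "open S" "\<And>x. x \<in> S \<Longrightarrow> (F has_derivative F' x) (at x)"
    and "\<And>i. Ck_on k S (\<lambda>x. F' x (axis i 1))"
  shows "Ck_on (Suc k) S F"
proof -
  have "Ck_on k S (\<lambda>x. der F x (axis i 1))" for i
    using assms(3)[of i] Ck_on_cong[OF assms(1), of "\<lambda>x. der F x (axis i 1)" "\<lambda>x. F' x (axis i 1)" k]
      der_eqI[OF assms(2)] by blast
  then show ?thesis
    using assms(2) unfolding Ck_on.simps differentiable_def by blast
qed

lemma Ck_on_SucD: "Ck_on (Suc k) S F \<Longrightarrow> Ck_on k S F"
proof (induction k arbitrary: F)
  case 0
  then show ?case
    by (auto intro!: continuous_at_imp_continuous_on differentiable_imp_continuous_within)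
qed auto

lemma Ck_on_continuous: "Ck_on k S F \<Longrightarrow> continuous_on S F"
  by (induction k) (simp, metis Ck_on_SucD)

lemma Ck_on_const: "Ck_on k S (\<lambda>x. c)"
  by (induction k arbitrary: c) auto

lemma Ck_on_bounded_linear:
  assumes "open S" "bounded_linear L"
  shows "Ck_on k S F \<Longrightarrow> Ck_on k S (\<lambda>x. L (F x))"
proof (induction k arbitrary: F)
  case 0
  then show ?case
    by (simp add: bounded_linear.continuous_on[OF assms(2)])
next
  case (Suc k)
  have D: "((\<lambda>x. L (F x)) has_derivative (\<lambda>v. L (der F x v))) (at x)" if "x \<in> S" for x
    by (intro bounded_linear.has_derivative[OF assms(2)] has_derivative_der) (use Suc.prems that in auto)
  have "Ck_on k S (\<lambda>x. L (der F x (axis i 1)))" for i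
    using Suc by simp
  note * = this
  show ?case
    by (rule Ck_on_SucI[OF assms(1) D], assumption, rule *)
qed

lemma Ck_on_add:
  assumes "open S"
  shows "Ck_on k S F \<Longrightarrow> Ck_on k S G \<Longrightarrow> Ck_on k S (\<lambda>x. F x + G x)"
proof (induction k arbitrary: F G)
  case 0
  then show ?case by (simp add: continuous_on_add)
next
  case (Suc k)
  have D: "((\<lambda>x. F x + G x) has_derivative (\<lambda>v. der F x v + der G x v)) (at x)" if "x \<in> S" for x
    by (intro has_derivative_add has_derivative_der) (use Suc.prems that in auto)
  have "Ck_on k S (\<lambda>x. der F x (axis i 1) + der G x (axis i 1))" for i
    using Suc by simp
  note * = this
  show ?case
    by (rule Ck_on_SucI[OF assms(1) D], assumption, rule *)
qed

lemma Ck_on_bounded_bilinear: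
  assumes "open S" "bounded_bilinear p"
  shows "Ck_on k S F \<Longrightarrow> Ck_on k S G \<Longrightarrow> Ck_on k S (\<lambda>x. p (F x) (G x))"
proof (induction k arbitrary: F G)
  case 0
  then show ?case by (simp add: bounded_bilinear.continuous_on[OF assms(2)])
next
  case (Suc k)
  have D: "((\<lambda>x. p (F x) (G x)) has_derivative (\<lambda>v. p (F x) (der G x v) + p (der F x v) (G x))) (at x)"
    if "x \<in> S" for x
    by (intro bounded_bilinear.FDERIV[OF assms(2)] has_derivative_der) (use Suc.prems that in auto)
  have "Ck_on k S (\<lambda>x. p (F x) (der G x (axis i 1)) + p (der F x (axis i 1)) (G x))" for i
    using Suc.prems Ck_on_SucD[OF Suc.prems(1)] Ck_on_SucD[OF Suc.prems(2)]
    by (auto intro!: Ck_on_add[OF assms(1)] Suc.IH)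
  note * = this
  show ?case
    by (rule Ck_on_SucI[OF assms(1) D], assumption, rule *)
qed

lemma Ck_on_sum:
  assumes "open S"
  shows "(\<And>a. a \<in> A \<Longrightarrow> Ck_on k S (F a)) \<Longrightarrow> Ck_on k S (\<lambda>x. \<Sum>a\<in>A. F a x)"
  by (induction A rule: infinite_finite_induct) (auto intro: Ck_on_const Ck_on_add[OF assms])

lemma Ck_on_compose:
  fixes f :: "real^'m \<Rightarrow> real^'n"
  assumes "open S" "open T" "f ` S \<subseteq> T"
  shows "Ck_on k S f \<Longrightarrow> Ck_on k T h \<Longrightarrow> Ck_on k S (\<lambda>x. h (f x))"
proof (induction k arbitrary: h)
  case 0
  then show ?case
    using assms(3) by (auto intro: continuous_on_compose2)
next
  case (Suc k)
  have D: "((\<lambda>x. h (f x)) has_derivative (\<lambda>v. der h (f x) (der f x v))) (at x)" if "x \<in> S" for x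
  proof (rule has_derivative_compose[of f _ x UNIV h])
    show "(f has_derivative der f x) (at x)"
      using Suc.prems(1) that has_derivative_der by auto
    show "(h has_derivative der h (f x)) (at (f x))"
      using Suc.prems(2) that assms(3) has_derivative_der by auto
  qed
  \<comment> \<open>The derivative of \<open>h\<close> is taken in the direction
    \<open>der f x (axis i 1)\<close>, which varies with \<open>x\<close>, whereas
    \<open>Ck_on\<close> controls coordinate directions; hence the expansion in partial derivatives
    of \<open>h\<close>, to which the induction hypothesis applies.\<close>
  have "Ck_on k S (\<lambda>x. \<Sum>j\<in>UNIV. (der f x (axis i 1)) $ j *\<^sub>R der h (f x) (axis j 1))" for i
    using Suc.prems Ck_on_SucD[OF Suc.prems(1)]
    by (intro Ck_on_sum Ck_on_bounded_bilinear[OF assms(1) bounded_bilinear_scaleR]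
        Ck_on_bounded_linear[OF assms(1) bounded_linear_vec_nth] assms(1) Suc.IH) auto
  moreover have "der h (f x) (der f x v) = (\<Sum>j\<in>UNIV. (der f x v) $ j *\<^sub>R der h (f x) (axis j 1))"
    if "x \<in> S" for x v
    using Suc.prems(2) assms(3) that by (intro der_axis_expansion) auto
  ultimately have "Ck_on k S (\<lambda>x. der h (f x) (der f x (axis i 1)))" for i
    by (subst Ck_on_cong[OF assms(1)])
  note * = this
  show ?case
    by (rule Ck_on_SucI[OF assms(1) D], assumption, rule *)
qed

text \<open>The derivative -F'/F^2 is a product containing \<open>inverse (F x)\<close> itself, so
  regularity of order \<open>k\<close> of the inverse supplies order \<open>k + 1\<close>.\<close>

lemma Ck_on_inverse:
  fixes F :: "real^'n \<Rightarrow> real"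
  assumes "open S" "\<And>x. x \<in> S \<Longrightarrow> F x \<noteq> 0"
  shows "Ck_on k S F \<Longrightarrow> Ck_on k S (\<lambda>x. inverse (F x))"
proof (induction k)
  case 0
  then show ?case using assms by (auto intro: continuous_on_inverse)
next
  case (Suc k)
  have D: "((\<lambda>x. inverse (F x)) has_derivative (\<lambda>v. - (inverse (F x) * der F x v * inverse (F x)))) (at x)"
    if "x \<in> S" for x
    by (intro Deriv.has_derivative_inverse has_derivative_der) (use Suc.prems that assms in auto)
  have "Ck_on k S (\<lambda>x. - (inverse (F x) * der F x (axis i 1) * inverse (F x)))" for i
    using Suc.prems Ck_on_SucD[OF Suc.prems]
    by (intro Ck_on_bounded_linear[OF assms(1) bounded_linear_minus[OF bounded_linear_ident]]
       Ck_on_bounded_bilinear[OF assms(1) bounded_bilinear_mult] Suc.IH) auto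
  note * = this
  show ?case
    by (rule Ck_on_SucI[OF assms(1) D], assumption, rule *)
qed

lemma Ck_on_sqrt:
  fixes F :: "real^'n \<Rightarrow> real"
  assumes "open S" "\<And>x. x \<in> S \<Longrightarrow> F x > 0"
  shows "Ck_on k S F \<Longrightarrow> Ck_on k S (\<lambda>x. sqrt (F x))"
proof (induction k)
  case 0
  then show ?case by (auto intro: continuous_on_real_sqrt)
next
  case (Suc k)
  have D: "((\<lambda>x. sqrt (F x)) has_derivative (\<lambda>v. der F x v * inverse (2 * sqrt (F x)))) (at x)"
    if "x \<in> S" for x
  proof -
    have "F x > 0" "(F has_derivative der F x) (at x)"
      using Suc.prems that assms has_derivative_der by auto
    then show ?thesis
      by (auto intro!: derivative_eq_intros simp: field_simps)
  qed
  have "Ck_on k S (\<lambda>x. der F x (axis i 1) * inverse (2 * sqrt (F x)))" for i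
  proof (rule Ck_on_bounded_bilinear[OF assms(1) bounded_bilinear_mult])
    show "Ck_on k S (\<lambda>x. der F x (axis i 1))" using Suc.prems by auto
    have "2 * sqrt (F x) \<noteq> 0" if "x \<in> S" for x using assms(2)[OF that] by simp
    then show "Ck_on k S (\<lambda>x. inverse (2 * sqrt (F x)))"
      by (intro Ck_on_inverse[OF assms(1)] Ck_on_bounded_linear[OF assms(1) bounded_linear_mult_right]
          Suc.IH Ck_on_SucD[OF Suc.prems])
  qed
  note * = this
  show ?case
    by (rule Ck_on_SucI[OF assms(1) D], assumption, rule *)
qed

lemma smooth_on_differentiable: "smooth_on S F \<Longrightarrow> x \<in> S \<Longrightarrow> F differentiable (at x)"
  unfolding smooth_on_def by (metis Ck_on.simps(2))

lemma smooth_on_continuous: "smooth_on S F \<Longrightarrow> continuous_on S F"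
  unfolding smooth_on_def using Ck_on_continuous by blast

lemma smooth_on_subset: "smooth_on S F \<Longrightarrow> T \<subseteq> S \<Longrightarrow> smooth_on T F"
  unfolding smooth_on_def using Ck_on_subset by blast

lemma smooth_on_cong:
  "open S \<Longrightarrow> (\<And>y. y \<in> S \<Longrightarrow> F y = G y) \<Longrightarrow> smooth_on S F \<longleftrightarrow> smooth_on S G"
  unfolding smooth_on_def using Ck_on_cong[of S F G] by blast

lemma smooth_on_const: "smooth_on S (\<lambda>x. c)"
  unfolding smooth_on_def using Ck_on_const by blast

lemma smooth_on_bounded_linear:
  "open S \<Longrightarrow> bounded_linear L \<Longrightarrow> smooth_on S F \<Longrightarrow> smooth_on S (\<lambda>x. L (F x))"
  unfolding smooth_on_def by (simp add: Ck_on_bounded_linear[where L = L and F = F])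

lemma smooth_on_add:
  "open S \<Longrightarrow> smooth_on S F \<Longrightarrow> smooth_on S G \<Longrightarrow> smooth_on S (\<lambda>x. F x + G x)"
  unfolding smooth_on_def by (simp add: Ck_on_add[where F = F and G = G])

lemma smooth_on_bounded_bilinear:
  "open S \<Longrightarrow> bounded_bilinear p \<Longrightarrow> smooth_on S F \<Longrightarrow> smooth_on S G \<Longrightarrow> smooth_on S (\<lambda>x. p (F x) (G x))"
  unfolding smooth_on_def by (simp add: Ck_on_bounded_bilinear[where p = p and F = F and G = G])

lemmas smooth_on_scaleR = smooth_on_bounded_bilinear[OF _ bounded_bilinear_scaleR]
lemmas smooth_on_mult = smooth_on_bounded_bilinear[OF _ bounded_bilinear_mult]
lemmas smooth_on_vec_nth = smooth_on_bounded_linear[OF _ bounded_linear_vec_nth]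

lemma smooth_on_minus: "open S \<Longrightarrow> smooth_on S F \<Longrightarrow> smooth_on S (\<lambda>x. - F x)"
  using smooth_on_bounded_linear[OF _ bounded_linear_minus[OF bounded_linear_ident]] .

lemma smooth_on_diff:
  "open S \<Longrightarrow> smooth_on S F \<Longrightarrow> smooth_on S G \<Longrightarrow> smooth_on S (\<lambda>x. F x - G x)"
  using smooth_on_add[of S F "\<lambda>x. - G x"] smooth_on_minus[of S G] by simp

lemma smooth_on_sum:
  "open S \<Longrightarrow> (\<And>a. a \<in> A \<Longrightarrow> smooth_on S (F a)) \<Longrightarrow> smooth_on S (\<lambda>x. \<Sum>a\<in>A. F a x)"
  unfolding smooth_on_def by (simp add: Ck_on_sum[where F = F])

lemma smooth_on_prod:
  fixes F :: "'a \<Rightarrow> real^'n \<Rightarrow> real"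
  assumes "open S"
  shows "(\<And>a. a \<in> A \<Longrightarrow> smooth_on S (F a)) \<Longrightarrow> smooth_on S (\<lambda>x. \<Prod>a\<in>A. F a x)"
  by (induction A rule: infinite_finite_induct) (simp_all add: smooth_on_const smooth_on_mult[OF assms, where F = "F _"])

lemma smooth_on_compose:
  fixes f :: "real^'m \<Rightarrow> real^'n"
  shows "open S \<Longrightarrow> open T \<Longrightarrow> f ` S \<subseteq> T \<Longrightarrow> smooth_on S f \<Longrightarrow> smooth_on T h \<Longrightarrow> smooth_on S (\<lambda>x. h (f x))"
  unfolding smooth_on_def by (simp add: Ck_on_compose[where f = f and h = h])

lemma smooth_on_inverse:
  fixes F :: "real^'n \<Rightarrow> real"
  shows "open S \<Longrightarrow> (\<And>x. x \<in> S \<Longrightarrow> F x \<noteq> 0) \<Longrightarrow> smooth_on S F \<Longrightarrow> smooth_on S (\<lambda>x. inverse (F x))"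
  unfolding smooth_on_def by (simp add: Ck_on_inverse[where F = F])

lemma smooth_on_sqrt:
  fixes F :: "real^'n \<Rightarrow> real"
  shows "open S \<Longrightarrow> (\<And>x. x \<in> S \<Longrightarrow> F x > 0) \<Longrightarrow> smooth_on S F \<Longrightarrow> smooth_on S (\<lambda>x. sqrt (F x))"
  unfolding smooth_on_def by (simp add: Ck_on_sqrt[where F = F])

lemma smooth_on_der:
  assumes "open S" "smooth_on S F"
  shows "smooth_on S (\<lambda>x. der F x v)"
proof -
  have "smooth_on S (\<lambda>x. der F x (axis i 1))" for i
    using assms(2) unfolding smooth_on_def by (metis Ck_on.simps(2))
  then have "smooth_on S (\<lambda>x. \<Sum>i\<in>UNIV. v $ i *\<^sub>R der F x (axis i 1))"
    by (intro smooth_on_sum assms(1) smooth_on_scaleR smooth_on_const)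
  then show ?thesis
    by (subst smooth_on_cong[OF assms(1)]) (rule der_axis_expansion[OF smooth_on_differentiable[OF assms(2)]])
qed

text \<open>Lifts smoothness from fixed arguments to smooth fields: the coordinates of
  \<open>V x\<close> become smooth coefficients. In this way \<open>der f\<close> and
  \<open>christoffel\<close>, known to be smooth on constant vectors, are applied to vector
  fields.\<close>

lemma smooth_on_linear_apply:
  fixes V :: "real^'m \<Rightarrow> real^'n"
  assumes "open S" "smooth_on S V" "\<And>v. smooth_on S (\<lambda>x. L x v)" "\<And>x. x \<in> S \<Longrightarrow> linear (L x)"
  shows "smooth_on S (\<lambda>x. L x (V x))"
proof -
  have "smooth_on S (\<lambda>x. \<Sum>i\<in>UNIV. V x $ i *\<^sub>R L x (axis i 1))"
    by (intro smooth_on_sum smooth_on_scaleR smooth_on_vec_nth assms)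
  moreover have "L x (V x) = (\<Sum>i\<in>UNIV. V x $ i *\<^sub>R L x (axis i 1))" if "x \<in> S" for x
    by (rule linear_axis_expansion[OF assms(4)[OF that]])
  ultimately show ?thesis
    by (subst smooth_on_cong[OF assms(1)])
qed

lemma smooth_on_vec_lambda:
  assumes "open S" "\<And>i. smooth_on S (\<lambda>x. F x i :: real)"
  shows "smooth_on S (\<lambda>x. \<chi> i. F x i)"
proof -
  have "(\<chi> i. F x i) = (\<Sum>i\<in>UNIV. F x i *\<^sub>R axis i 1)" for x
    by (subst axis_expansion) simp
  moreover have "smooth_on S (\<lambda>x. \<Sum>i\<in>UNIV. F x i *\<^sub>R axis i 1 :: real^_)"
    by (intro smooth_on_sum smooth_on_scaleR smooth_on_const assms)
  ultimately show ?thesis by presburger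
qed

section \<open>Determinants and inverses of matrices with smooth entries\<close>

lemma smooth_on_det:
  fixes A :: "real^'m \<Rightarrow> real^'n^'n"
  assumes "open S" "\<And>i j. smooth_on S (\<lambda>x. A x $ i $ j)"
  shows "smooth_on S (\<lambda>x. det (A x))"
  unfolding det_def
  by (intro smooth_on_sum smooth_on_mult smooth_on_prod smooth_on_const assms)

lemma matrix_inv_works:
  fixes A :: "real^'n^'n"
  assumes "invertible A"
  shows "A ** matrix_inv A = mat 1" "matrix_inv A ** A = mat 1"
  using someI_ex[of "\<lambda>A'. A ** A' = mat 1 \<and> A' ** A = mat 1"] assms
  unfolding invertible_def matrix_inv_def by auto

lemma matrix_inv_mult_cancel:
  fixes A :: "real^'n^'n"
  assumes "invertible A"
  shows "A *v (matrix_inv A *v b) = b" "matrix_inv A *v (A *v b) = b"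
  using matrix_inv_works[OF assms] by (simp_all add: matrix_vector_mul_assoc)

text \<open>By Cramer's rule the components of the solution are quotients of determinants, which are
  polynomials in smooth entries, and the denominator \<open>det (A x)\<close> has no zeros on
  \<open>S\<close>.\<close>

lemma smooth_on_matrix_inv_apply:
  fixes A :: "real^'m \<Rightarrow> real^'n^'n"
  assumes "open S" "smooth_on S A" "\<And>x. x \<in> S \<Longrightarrow> invertible (A x)" "smooth_on S b"
  shows "smooth_on S (\<lambda>x. matrix_inv (A x) *v b x)"
proof -
  have Aij: "smooth_on S (\<lambda>x. A x $ i $ j)" for i j
    by (intro smooth_on_vec_nth assms)
  have bi: "smooth_on S (\<lambda>x. b x $ i)" for i
    by (intro smooth_on_vec_nth assms)
  have d: "det (A x) \<noteq> 0" if "x \<in> S" for x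
    using assms(3)[OF that] invertible_det_nz by blast
  have "smooth_on S (\<lambda>x. (if j = k then b x $ i else A x $ i $ j))" for i j k
    by (cases "j = k") (simp_all add: Aij bi)
  then have "smooth_on S (\<lambda>x. \<chi> k. det (\<chi> i j. if j = k then b x $ i else A x $ i $ j) * inverse (det (A x)))"
    by (intro smooth_on_vec_lambda smooth_on_mult smooth_on_det smooth_on_inverse Aij assms d) auto
  moreover have "matrix_inv (A x) *v b x =
      (\<chi> k. det (\<chi> i j. if j = k then b x $ i else A x $ i $ j) * inverse (det (A x)))" if "x \<in> S" for x
    using cramer[OF d[OF that], of "matrix_inv (A x) *v b x" "b x"]
      matrix_inv_mult_cancel(1)[OF assms(3)[OF that], of "b x"]
    by (simp add: divide_inverse)
  ultimately show ?thesis
    by (subst smooth_on_cong[OF assms(1)])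
qed

section \<open>Symmetry of second derivatives\<close>

text \<open>Two mean value theorems. The second difference is the increment over [0, r] of s -> F(x
  + s v + r w) - F(x + s v); the derivative of this function is an increment of the
  \<open>v\<close>-derivative of \<open>F\<close> in the direction \<open>w\<close>, to which the
  theorem applies again.\<close>

lemma second_difference:
  fixes F :: "real^'n \<Rightarrow> real"
  assumes F: "\<And>y. y \<in> ball x d \<Longrightarrow> F differentiable (at y)"
    and F': "\<And>y. y \<in> ball x d \<Longrightarrow> (\<lambda>y. der F y v) differentiable (at y)"
    and r: "r > 0" "r * (norm v + norm w) < d"
  shows "\<exists>p\<in>ball x d. F (x + r *\<^sub>R v + r *\<^sub>R w) - F (x + r *\<^sub>R v) - F (x + r *\<^sub>R w) + F x
           = r\<^sup>2 * der (\<lambda>y. der F y v) p w"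
proof -
  have inb: "x + s *\<^sub>R v + t *\<^sub>R w \<in> ball x d" if "0 \<le> s" "s \<le> r" "0 \<le> t" "t \<le> r" for s t
  proof -
    have "norm (s *\<^sub>R v + t *\<^sub>R w) \<le> s * norm v + t * norm w"
      using norm_triangle_ineq[of "s *\<^sub>R v" "t *\<^sub>R w"] that by simp
    also have "\<dots> \<le> r * norm v + r * norm w"
      using that by (intro add_mono mult_right_mono) auto
    also have "\<dots> < d" using r(2) by (simp add: distrib_left)
    finally have "norm (s *\<^sub>R v + t *\<^sub>R w) < d" .
    moreover have "dist x (x + s *\<^sub>R v + t *\<^sub>R w) = norm (s *\<^sub>R v + t *\<^sub>R w)"
      unfolding dist_norm using norm_minus_cancel[of "s *\<^sub>R v + t *\<^sub>R w"] by (simp add: algebra_simps)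
    ultimately show ?thesis by simp
  qed
  define G where "G s = F (x + s *\<^sub>R v + r *\<^sub>R w) - F (x + s *\<^sub>R v)" for s
  have G': "(G has_derivative (\<lambda>z. z * (der F (x + s *\<^sub>R v + r *\<^sub>R w) v - der F (x + s *\<^sub>R v) v))) (at s)"
    if "0 \<le> s" "s \<le> r" for s
  proof -
    have d1: "(F has_derivative der F (x + s *\<^sub>R v + r *\<^sub>R w)) (at (x + s *\<^sub>R v + r *\<^sub>R w))"
      by (intro has_derivative_der F inb) (use that r(1) in auto)
    have d2: "(F has_derivative der F (x + s *\<^sub>R v)) (at (x + s *\<^sub>R v))"
      using inb[of s 0] by (intro has_derivative_der F) (use that r(1) in auto)
    have "((\<lambda>s. x + s *\<^sub>R v + r *\<^sub>R w) has_derivative (\<lambda>z. z *\<^sub>R v)) (at s)"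
      "((\<lambda>s. x + s *\<^sub>R v) has_derivative (\<lambda>z. z *\<^sub>R v)) (at s)"
      by (auto intro!: derivative_eq_intros)
    from has_derivative_diff[OF has_derivative_compose[OF this(1) d1] has_derivative_compose[OF this(2) d2]]
    have "(G has_derivative (\<lambda>z. der F (x + s *\<^sub>R v + r *\<^sub>R w) (z *\<^sub>R v) - der F (x + s *\<^sub>R v) (z *\<^sub>R v))) (at s)"
      unfolding G_def .
    then show ?thesis
      using linear_cmul[OF has_derivative_linear[OF d1]] linear_cmul[OF has_derivative_linear[OF d2]]
      by (simp add: right_diff_distrib)
  qed
  obtain s where s: "0 < s" "s < r" "G r - G 0 = (r - 0) * (der F (x + s *\<^sub>R v + r *\<^sub>R w) v - der F (x + s *\<^sub>R v) v)"
    using mvt_simple[OF r(1) has_derivative_at_withinI[OF G']] by auto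
  define K where "K t = der F (x + s *\<^sub>R v + t *\<^sub>R w) v" for t
  have K': "(K has_derivative (\<lambda>z. z * der (\<lambda>y. der F y v) (x + s *\<^sub>R v + t *\<^sub>R w) w)) (at t)"
    if "0 \<le> t" "t \<le> r" for t
  proof -
    have d1: "((\<lambda>y. der F y v) has_derivative der (\<lambda>y. der F y v) (x + s *\<^sub>R v + t *\<^sub>R w)) (at (x + s *\<^sub>R v + t *\<^sub>R w))"
      by (intro has_derivative_der F' inb) (use that s(1,2) in auto)
    have "((\<lambda>t. x + s *\<^sub>R v + t *\<^sub>R w) has_derivative (\<lambda>z. z *\<^sub>R w)) (at t)"
      by (auto intro!: derivative_eq_intros)
    from has_derivative_compose[OF this d1] show ?thesis
      using linear_cmul[OF has_derivative_linear[OF d1]] unfolding K_def by simp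
  qed
  obtain t where t: "0 < t" "t < r" "K r - K 0 = (r - 0) * der (\<lambda>y. der F y v) (x + s *\<^sub>R v + t *\<^sub>R w) w"
    using mvt_simple[OF r(1) has_derivative_at_withinI[OF K']] by auto
  have "G r - G 0 = r\<^sup>2 * der (\<lambda>y. der F y v) (x + s *\<^sub>R v + t *\<^sub>R w) w"
    using s(3) t(3) by (simp add: K_def power2_eq_square)
  then show ?thesis
    using inb[of s t] s(1,2) t(1,2)
    by (intro bexI[of _ "x + s *\<^sub>R v + t *\<^sub>R w"]) (simp_all add: G_def)
qed

text \<open>The second difference is symmetric in \<open>v\<close> and \<open>w\<close>, so the two
  mixed derivatives take a common value at two points near \<open>x\<close>; continuity carries the
  equality over to \<open>x\<close>.\<close>

lemma der_der_commute_real: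
  fixes F :: "real^'n \<Rightarrow> real"
  assumes "open S" "smooth_on S F" "x \<in> S"
  shows "der (\<lambda>y. der F y v) x w = der (\<lambda>y. der F y w) x v"
proof (rule ccontr)
  define A where "A y = der (\<lambda>y. der F y v) y w" for y
  define B where "B y = der (\<lambda>y. der F y w) y v" for y
  assume "\<not> ?thesis"
  then have ne: "A x - B x \<noteq> 0" by (simp add: A_def B_def)
  \<comment> \<open>Half the gap: if both mixed derivatives stay within \<open>e\<close> of their
    values at \<open>x\<close> and share a common value, the gap would be smaller than
    itself.\<close>
  define e where "e = \<bar>A x - B x\<bar> / 2"
  have "e > 0" using ne by (simp add: e_def)
  have "continuous_on S A" "continuous_on S B"
    unfolding A_def B_def by (intro smooth_on_continuous smooth_on_der assms)+
  then have "isCont A x" "isCont B x"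
    using assms(1,3) by (simp_all add: continuous_on_eq_continuous_at)
  then obtain d1 d2 where d: "d1 > 0" "\<And>y. dist y x < d1 \<Longrightarrow> dist (A y) (A x) < e"
      "d2 > 0" "\<And>y. dist y x < d2 \<Longrightarrow> dist (B y) (B x) < e"
    unfolding continuous_at_eps_delta using \<open>e > 0\<close> by metis
  obtain d3 where d3: "d3 > 0" "ball x d3 \<subseteq> S"
    using assms(1,3) open_contains_ball by blast
  define d0 where "d0 = min d1 (min d2 d3)"
  \<comment> \<open>Chosen so that all corners of the second difference lie in the ball of radius
    \<open>d0\<close>; the summand 1 keeps the denominator positive when both vectors
    vanish.\<close>
  define r where "r = d0 / (2 * (norm v + norm w + 1))"
  have "d0 > 0" using d(1,3) d3(1) by (simp add: d0_def)
  then have r: "r > 0" by (simp add: r_def add_nonneg_pos)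
  have "r * (norm v + norm w) < d0"
  proof -
    define n where "n = norm v + norm w"
    have "n \<ge> 0" by (simp add: n_def)
    have "d0 * n \<le> d0 * (n + 1)" using \<open>d0 > 0\<close> by simp
    also have "\<dots> < d0 * (2 * (n + 1))" using \<open>d0 > 0\<close> \<open>n \<ge> 0\<close> by simp
    finally show ?thesis using \<open>n \<ge> 0\<close> by (simp add: r_def n_def[symmetric] pos_divide_less_eq)
  qed
  moreover have S: "y \<in> S" if "y \<in> ball x d0" for y using d3(2) that by (auto simp: d0_def)
  moreover have D: "F differentiable (at y)" "(\<lambda>y. der F y v) differentiable (at y)"
     "(\<lambda>y. der F y w) differentiable (at y)" if "y \<in> S" for y
    using that by (auto intro!: smooth_on_differentiable[of S] smooth_on_der assms)
  ultimately have
    "\<exists>p\<in>ball x d0. F (x + r *\<^sub>R v + r *\<^sub>R w) - F (x + r *\<^sub>R v) - F (x + r *\<^sub>R w) + F x = r\<^sup>2 * A p"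
    "\<exists>q\<in>ball x d0. F (x + r *\<^sub>R w + r *\<^sub>R v) - F (x + r *\<^sub>R w) - F (x + r *\<^sub>R v) + F x = r\<^sup>2 * B q"
    unfolding A_def B_def using r
    by (intro second_difference D S; simp add: add.commute)+
  then obtain p q where p: "p \<in> ball x d0" "q \<in> ball x d0"
      "F (x + r *\<^sub>R v + r *\<^sub>R w) - F (x + r *\<^sub>R v) - F (x + r *\<^sub>R w) + F x = r\<^sup>2 * A p"
      "F (x + r *\<^sub>R w + r *\<^sub>R v) - F (x + r *\<^sub>R w) - F (x + r *\<^sub>R v) + F x = r\<^sup>2 * B q"
    by blast
  have "r\<^sup>2 * A p = r\<^sup>2 * B q"
    using p(3,4) by (simp add: algebra_simps)
  then have "A p = B q" using r by simp
  moreover have "dist (A p) (A x) < e" "dist (B q) (B x) < e"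
    using d(2)[of p] d(4)[of q] p(1,2) by (auto simp: d0_def dist_commute)
  ultimately have "dist (A x) (B x) < e + e"
    using dist_triangle2[of "A x" "B x" "A p"] by (simp add: dist_commute)
  then show False
    by (simp add: e_def dist_real_def)
qed

lemma der_bounded_linear_comp:
  assumes "bounded_linear L" "F differentiable (at x)"
  shows "der (\<lambda>x. L (F x)) x v = L (der F x v)"
  by (rule der_eqI) (intro bounded_linear.has_derivative[OF assms(1)] has_derivative_der assms(2))

text \<open>Reduction to the real case: taking the inner product with a fixed \<open>b\<close>
  commutes with \<open>der\<close>, and a vector orthogonal to every \<open>b\<close> is
  zero.\<close>

lemma der_der_commute:
  fixes F :: "real^'n \<Rightarrow> 'b::real_inner"
  assumes "open S" "smooth_on S F" "x \<in> S"
  shows "der (\<lambda>y. der F y v) x w = der (\<lambda>y. der F y w) x v" (is "?A = ?B")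
proof -
  have key: "b \<bullet> der (\<lambda>y. der F y v) x w = der (\<lambda>y. der (\<lambda>y. b \<bullet> F y) y v) x w" for b v w
  proof -
    have "der (\<lambda>y. b \<bullet> der F y v) x w = b \<bullet> der (\<lambda>y. der F y v) x w"
      by (intro der_bounded_linear_comp bounded_linear_inner_right smooth_on_differentiable[of S] smooth_on_der assms)
    moreover have "der (\<lambda>y. der (\<lambda>y. b \<bullet> F y) y v) x = der (\<lambda>y. b \<bullet> der F y v) x"
      using smooth_on_differentiable[OF assms(2)]
      by (intro der_cong_open[OF assms(1,3)] der_bounded_linear_comp bounded_linear_inner_right) auto
    ultimately show ?thesis by metis
  qed
  have "b \<bullet> der (\<lambda>y. der F y v) x w = b \<bullet> der (\<lambda>y. der F y w) x v" for b
    unfolding key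
    by (intro der_der_commute_real[OF assms(1) _ assms(3)]
        smooth_on_bounded_linear[OF assms(1) bounded_linear_inner_right] assms)
  then have "(?A - ?B) \<bullet> (?A - ?B) = 0"
    by (simp add: inner_diff_right)
  then show ?thesis by simp
qed

section \<open>The inner product of a coefficient matrix\<close>

lemma ip_add_left: "ip A (v + v') w = ip A v w + ip A v' w"
  by (simp add: ip_def inner_add_left)

lemma ip_add_right: "ip A v (w + w') = ip A v w + ip A v w'"
  by (simp add: ip_def inner_add_right matrix_vector_right_distrib)

lemma ip_scaleR_left: "ip A (r *\<^sub>R v) w = r * ip A v w"
  by (simp add: ip_def)

lemma ip_scaleR_right: "ip A v (r *\<^sub>R w) = r * ip A v w"
  by (simp add: ip_def matrix_vector_mult_scaleR)

lemma ip_minus_left: "ip A (- v) w = - ip A v w"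
  using ip_scaleR_left[of A "-1"] by simp

lemma ip_minus_right: "ip A v (- w) = - ip A v w"
  using ip_scaleR_right[of A v "-1"] by simp

lemma ip_diff_left: "ip A (v - v') w = ip A v w - ip A v' w"
  by (simp add: ip_def inner_diff_left)

lemma ip_diff_right: "ip A v (w - w') = ip A v w - ip A v w'"
  by (simp add: ip_def inner_diff_right matrix_vector_mult_diff_distrib)

lemma ip_zero_left: "ip A 0 w = 0"
  by (simp add: ip_def)

lemma ip_zero_right: "ip A v 0 = 0"
  by (simp add: ip_def)

lemma ip_sum_left: "ip A (\<Sum>i\<in>I. v i) w = (\<Sum>i\<in>I. ip A (v i) w)"
  by (simp add: ip_def inner_sum_left)

lemmas ip_linear = ip_add_left ip_add_right ip_scaleR_left ip_scaleR_right ip_minus_left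
  ip_minus_right ip_diff_left ip_diff_right ip_zero_left ip_zero_right

lemma linear_ip_left: "linear (\<lambda>v. ip A v w)"
  by (rule linearI) (simp_all add: ip_linear)

lemma linear_ip_right: "linear (\<lambda>w. ip A v w)"
  by (rule linearI) (simp_all add: ip_linear)

lemma bounded_bilinear_matrix_vector_mult: "bounded_bilinear ((*v) :: real^'n^'m \<Rightarrow> real^'n \<Rightarrow> real^'m)"
  unfolding bilinear_conv_bounded_bilinear[symmetric] bilinear_def
  by (auto intro!: linearI simp: matrix_vector_right_distrib matrix_vector_mult_scaleR
      matrix_vector_mult_add_rdistrib scaleR_matrix_vector_assoc)

lemma has_derivative_ip:
  assumes "(A has_derivative A') (at x)" "(v has_derivative v') (at x)" "(w has_derivative w') (at x)"
  shows "((\<lambda>y. ip (A y) (v y) (w y)) has_derivative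
    (\<lambda>z. ip (A' z) (v x) (w x) + ip (A x) (v' z) (w x) + ip (A x) (v x) (w' z))) (at x)"
  unfolding ip_def
  by (rule has_derivative_eq_rhs, rule has_derivative_inner[OF assms(2)],
      rule bounded_bilinear.FDERIV[OF bounded_bilinear_matrix_vector_mult assms(1,3)])
     (simp add: fun_eq_iff inner_add_right)

lemma smooth_on_ip:
  assumes "open S" "smooth_on S A" "smooth_on S v" "smooth_on S w"
  shows "smooth_on S (\<lambda>y. ip (A y) (v y) (w y))"
  unfolding ip_def
  by (rule smooth_on_bounded_bilinear[OF assms(1) bounded_bilinear_inner assms(3)],
      rule smooth_on_bounded_bilinear[OF assms(1) bounded_bilinear_matrix_vector_mult assms(2,4)])

section \<open>The Levi-Civita connection\<close>

locale metric_domain =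
  fixes V :: "(real^'n) set" and h :: "real^'n \<Rightarrow> real^'n^'n"
  assumes open_dom: "open V" and metric: "riemannian_metric_on V h"
begin

lemma smooth_metric: "smooth_on V h"
  using metric by (simp add: riemannian_metric_on_def)

lemma ip_commute: "x \<in> V \<Longrightarrow> ip (h x) v w = ip (h x) w v"
  using metric by (simp add: riemannian_metric_on_def)

lemma ip_pos: "x \<in> V \<Longrightarrow> v \<noteq> 0 \<Longrightarrow> ip (h x) v v > 0"
  using metric by (simp add: riemannian_metric_on_def)

lemma ip_eq_zero_iff: "x \<in> V \<Longrightarrow> ip (h x) v v = 0 \<longleftrightarrow> v = 0"
  using ip_pos[of x v] by (cases "v = 0") (auto simp: ip_zero_left)

text \<open>Equations between vectors that are defined through \<open>matrix_inv\<close> are proved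
  by pairing, so that the inverse matrix never has to be computed.\<close>

lemma ip_nondegenerate:
  assumes "x \<in> V" "\<And>z. ip (h x) a z = ip (h x) b z"
  shows "a = b"
proof -
  have "ip (h x) (a - b) (a - b) = 0"
    using assms(2)[of "a - b"] by (simp add: ip_diff_left)
  then show ?thesis using ip_eq_zero_iff[OF assms(1)] by simp
qed

lemma invertible_metric:
  assumes "x \<in> V"
  shows "invertible (h x)"
proof -
  have "v = 0" if "h x *v v = 0" for v
    using that ip_eq_zero_iff[OF assms, of v] by (simp add: ip_def)
  then show ?thesis
    by (simp add: invertible_left_inverse matrix_left_invertible_ker)
qed

lemma ip_matrix_inv:
  assumes "x \<in> V"
  shows "ip (h x) (matrix_inv (h x) *v b) z = b \<bullet> z"
proof -
  have "ip (h x) (matrix_inv (h x) *v b) z = z \<bullet> (h x *v (matrix_inv (h x) *v b))"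
    unfolding ip_commute[OF assms, of _ z] by (simp add: ip_def)
  then show ?thesis
    using matrix_inv_mult_cancel(1)[OF invertible_metric[OF assms]] by (simp add: inner_commute)
qed

lemma has_derivative_metric: "x \<in> V \<Longrightarrow> (h has_derivative der h x) (at x)"
  using smooth_on_differentiable[OF smooth_metric] has_derivative_der by blast

lemma der_ip_const: "x \<in> V \<Longrightarrow> der (\<lambda>y. ip (h y) v w) x u = ip (der h x u) v w"
  using der_eqI[OF has_derivative_ip[OF has_derivative_metric has_derivative_const has_derivative_const]]
  by (simp add: ip_linear)

lemma ip_der_commute:
  assumes "x \<in> V"
  shows "ip (der h x u) v w = ip (der h x u) w v"
proof -
  have "der (\<lambda>y. ip (h y) v w) x = der (\<lambda>y. ip (h y) w v) x"
    by (rule der_cong_open[OF open_dom assms]) (rule ip_commute)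
  then show ?thesis
    using der_ip_const[OF assms, of v w u] der_ip_const[OF assms, of w v u] by simp
qed

lemma linear_der_metric: "x \<in> V \<Longrightarrow> linear (der h x)"
  by (rule linear_frechet_derivative) (rule smooth_on_differentiable[OF smooth_metric])

lemma ip_add_matrix: "ip (A + B) v w = ip A v w + ip B v w"
  by (simp add: ip_def matrix_vector_mult_add_rdistrib inner_add_right)

lemma ip_scaleR_matrix: "ip (r *\<^sub>R A) v w = r * ip A v w"
  by (simp add: ip_def scaleR_matrix_vector_assoc[symmetric])

lemma linear_ip_der: "x \<in> V \<Longrightarrow> linear (\<lambda>u. ip (der h x u) v w)"
  by (rule linearI)
     (simp_all add: linear_add[OF linear_der_metric] linear_cmul[OF linear_der_metric]
        ip_add_matrix ip_scaleR_matrix)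

text \<open>\<open>christoffel\<close> is defined by this formula for coordinate vectors in the last
  slot; both sides are linear in \<open>z\<close>, which gives all \<open>z\<close>.\<close>

lemma koszul:
  assumes "x \<in> V"
  shows "2 * ip (h x) (christoffel h x v w) z =
    ip (der h x v) w z + ip (der h x w) v z - ip (der h x z) v w"
proof -
  define L where "L z = (1/2) * (ip (der h x v) w z + ip (der h x w) v z - ip (der h x z) v w)" for z
  have "linear L"
    by (rule linearI)
       (simp_all add: L_def ip_linear linear_add[OF linear_ip_der[OF assms]]
          linear_cmul[OF linear_ip_der[OF assms]] field_simps)
  have "ip (h x) (christoffel h x v w) z = (\<chi> l. L (axis l 1)) \<bullet> z"
    unfolding christoffel_def ip_matrix_inv[OF assms] der_ip_const[OF assms] L_def ..
  also have "\<dots> = L z"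
    unfolding linear_axis_expansion[OF \<open>linear L\<close>, of z] by (simp add: inner_vec_def mult.commute)
  finally show ?thesis by (simp add: L_def)
qed

lemma christoffel_commute:
  assumes "x \<in> V"
  shows "christoffel h x v w = christoffel h x w v"
proof (rule ip_nondegenerate[OF assms])
  show "ip (h x) (christoffel h x v w) z = ip (h x) (christoffel h x w v) z" for z
    using koszul[OF assms, of v w z] koszul[OF assms, of w v z] ip_der_commute[OF assms, of z v w] by simp
qed

lemma linear_christoffel_right:
  assumes "x \<in> V"
  shows "linear (\<lambda>w. christoffel h x v w)"
proof (rule linearI)
  note lin = linear_add[OF linear_ip_der[OF assms]] linear_cmul[OF linear_ip_der[OF assms]]
  show "christoffel h x v (w + w') = christoffel h x v w + christoffel h x v w'" for w w'
  proof (rule ip_nondegenerate[OF assms])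
    show "ip (h x) (christoffel h x v (w + w')) z = ip (h x) (christoffel h x v w + christoffel h x v w') z" for z
      using koszul[OF assms, of v "w + w'" z] koszul[OF assms, of v w z] koszul[OF assms, of v w' z]
      by (simp add: ip_linear lin)
  qed
  show "christoffel h x v (r *\<^sub>R w) = r *\<^sub>R christoffel h x v w" for r w
  proof (rule ip_nondegenerate[OF assms])
    have "2 * ip (h x) (christoffel h x v (r *\<^sub>R w)) z = r * (2 * ip (h x) (christoffel h x v w) z)" for z
      unfolding koszul[OF assms] by (simp add: ip_linear lin algebra_simps)
    then show "ip (h x) (christoffel h x v (r *\<^sub>R w)) z = ip (h x) (r *\<^sub>R christoffel h x v w) z" for z
      by (simp add: ip_linear)
  qed
qed

lemma linear_christoffel_left:
  assumes "x \<in> V"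
  shows "linear (\<lambda>v. christoffel h x v w)"
  using linear_christoffel_right[OF assms, of w] unfolding christoffel_commute[OF assms, of w] .

lemmas christoffel_linear =
  linear_add[OF linear_christoffel_right] linear_add[OF linear_christoffel_left]
  linear_cmul[OF linear_christoffel_right] linear_cmul[OF linear_christoffel_left]
  linear_diff[OF linear_christoffel_right] linear_diff[OF linear_christoffel_left]
  linear_0[OF linear_christoffel_right] linear_0[OF linear_christoffel_left]

text \<open>In the sum of the Koszul formulas for (u, v, w) and (u, w, v) the terms differentiated
  along \<open>v\<close> and \<open>w\<close> cancel, and twice the derivative along
  \<open>u\<close> remains.\<close>

lemma metric_compatible:
  assumes "x \<in> V"
  shows "ip (der h x u) v w = ip (h x) (christoffel h x u v) w + ip (h x) v (christoffel h x u w)"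
  using koszul[OF assms, of u v w] koszul[OF assms, of u w v] ip_der_commute[OF assms, of u v w]
    ip_der_commute[OF assms, of v u w] ip_der_commute[OF assms, of w u v]
    ip_commute[OF assms, of v "christoffel h x u w"]
  by linarith

lemma smooth_christoffel: "smooth_on V (\<lambda>x. christoffel h x v w)"
  unfolding christoffel_def
  by (rule smooth_on_matrix_inv_apply[OF open_dom smooth_metric invertible_metric], assumption)
     (intro smooth_on_vec_lambda[OF open_dom] smooth_on_mult[OF open_dom] smooth_on_diff[OF open_dom]
       smooth_on_add[OF open_dom] smooth_on_der[OF open_dom] smooth_on_ip[OF open_dom]
       smooth_on_const smooth_metric)

lemma differentiable_christoffel: "x \<in> V \<Longrightarrow> (\<lambda>x. christoffel h x v w) differentiable (at x)"
  by (rule smooth_on_differentiable[OF smooth_christoffel])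

lemma linear_der_christoffel: "x \<in> V \<Longrightarrow> linear (\<lambda>u. der (\<lambda>y. christoffel h y v w) x u)"
  by (rule linear_frechet_derivative) (rule differentiable_christoffel)

lemma der_christoffel_commute:
  assumes "x \<in> V"
  shows "der (\<lambda>y. christoffel h y v w) x = der (\<lambda>y. christoffel h y w v) x"
  by (rule der_cong_open[OF open_dom assms]) (rule christoffel_commute)

lemma linear_der_christoffel_right:
  assumes "x \<in> V"
  shows "linear (\<lambda>w. der (\<lambda>y. christoffel h y v w) x u)"
proof (rule linearI)
  fix w w' r
  have D: "((\<lambda>y. christoffel h y v w) has_derivative der (\<lambda>y. christoffel h y v w) x) (at x)" for w
    by (rule has_derivative_der[OF differentiable_christoffel[OF assms]])
  have "der (\<lambda>y. christoffel h y v (w + w')) x = der (\<lambda>y. christoffel h y v w + christoffel h y v w') x"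
    by (rule der_cong_open[OF open_dom assms]) (simp add: christoffel_linear)
  then show "der (\<lambda>y. christoffel h y v (w + w')) x u = der (\<lambda>y. christoffel h y v w) x u + der (\<lambda>y. christoffel h y v w') x u"
    using der_eqI[OF has_derivative_add[OF D D]] by simp
  have "der (\<lambda>y. christoffel h y v (r *\<^sub>R w)) x = der (\<lambda>y. r *\<^sub>R christoffel h y v w) x"
    by (rule der_cong_open[OF open_dom assms]) (simp add: christoffel_linear)
  then show "der (\<lambda>y. christoffel h y v (r *\<^sub>R w)) x u = r *\<^sub>R der (\<lambda>y. christoffel h y v w) x u"
    using der_eqI[OF has_derivative_scaleR_right[OF D]] by simp
qed

lemma linear_der_christoffel_left:
  assumes "x \<in> V"
  shows "linear (\<lambda>v. der (\<lambda>y. christoffel h y v w) x u)"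
  using linear_der_christoffel_right[OF assms, of w] unfolding der_christoffel_commute[OF assms, of w] .

lemmas der_christoffel_linear =
  linear_add[OF linear_der_christoffel] linear_cmul[OF linear_der_christoffel]
  linear_add[OF linear_der_christoffel_right] linear_cmul[OF linear_der_christoffel_right]
  linear_add[OF linear_der_christoffel_left] linear_cmul[OF linear_der_christoffel_left]

section \<open>Spaces of constant curvature\<close>

lemma curvature_linear:
  assumes "x \<in> V"
  shows "curvature h x (u + u') v w = curvature h x u v w + curvature h x u' v w"
    and "curvature h x u (v + v') w = curvature h x u v w + curvature h x u v' w"
    and "curvature h x u v (w + w') = curvature h x u v w + curvature h x u v w'"
    and "curvature h x (r *\<^sub>R u) v w = r *\<^sub>R curvature h x u v w"
    and "curvature h x u (r *\<^sub>R v) w = r *\<^sub>R curvature h x u v w"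
    and "curvature h x u v (r *\<^sub>R w) = r *\<^sub>R curvature h x u v w"
  by (simp_all add: curvature_def christoffel_linear[OF assms] der_christoffel_linear[OF assms] algebra_simps)

lemma curvature_antisym: "curvature h x u v w = - curvature h x v u w"
  by (simp add: curvature_def)

text \<open>The connection is torsion-free and constant fields commute: by the symmetry of
  \<open>christoffel\<close> and of its derivatives the terms of the cyclic sum cancel in
  pairs.\<close>

lemma first_bianchi:
  assumes "x \<in> V"
  shows "curvature h x u v w + curvature h x v w u + curvature h x w u v = 0"
  by (simp add: curvature_def christoffel_commute[OF assms, of v u] christoffel_commute[OF assms, of w u]
      christoffel_commute[OF assms, of w v] der_christoffel_commute[OF assms, of v u]
      der_christoffel_commute[OF assms, of w u] der_christoffel_commute[OF assms, of w v])

text \<open>Differentiating \<open>ip (h y) w w\<close> along \<open>v\<close> and then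
  \<open>u\<close> yields 2<D_u D_v w, w> + 2<D_v w, D_u w>. Second derivatives commute and the last
  term is symmetric, so the commutator of the covariant derivatives of \<open>w\<close> is
  orthogonal to \<open>w\<close>.\<close>

lemma ip_curvature_self:
  assumes "x \<in> V"
  shows "ip (h x) (curvature h x u v w) w = 0"
proof -
  have D: "((\<lambda>y. christoffel h y v w) has_derivative der (\<lambda>y. christoffel h y v w) x) (at x)" for v w
    by (rule has_derivative_der[OF differentiable_christoffel[OF assms]])
  have second: "der (\<lambda>y. der (\<lambda>y. ip (h y) w w) y v) x u =
     2 * (ip (h x) (der (\<lambda>y. christoffel h y v w) x u + christoffel h x u (christoffel h x v w)) w +
       ip (h x) (christoffel h x v w) (christoffel h x u w))" for u v
  proof -
    have "der (\<lambda>y. der (\<lambda>y. ip (h y) w w) y v) x = der (\<lambda>y. 2 * ip (h y) (christoffel h y v w) w) x" (is "?L = ?R")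
      by (rule der_cong_open[OF open_dom assms])
         (simp add: der_ip_const metric_compatible ip_commute[of _ w])
    moreover have "?R u = 2 * (ip (der h x u) (christoffel h x v w) w +
        ip (h x) (der (\<lambda>y. christoffel h y v w) x u) w + ip (h x) (christoffel h x v w) 0)"
      by (rule der_eqI, rule has_derivative_mult_right)
         (rule has_derivative_ip[OF has_derivative_metric[OF assms] D has_derivative_const])
    ultimately show ?thesis
      by (simp add: metric_compatible[OF assms] ip_linear)
  qed
  have "smooth_on V (\<lambda>y. ip (h y) w w)"
    by (intro smooth_on_ip open_dom smooth_metric smooth_on_const)
  from der_der_commute[OF open_dom this assms, of v u]
  show ?thesis
    unfolding second curvature_def
    using ip_commute[OF assms, of "christoffel h x v w" "christoffel h x u w"]
    by (simp add: ip_linear)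
qed

text \<open>Polarisation of \<open>ip_curvature_self\<close> at \<open>w + z\<close>.\<close>

lemma ip_curvature_antisym:
  assumes "x \<in> V"
  shows "ip (h x) (curvature h x u v w) z = - ip (h x) (curvature h x u v z) w"
  using ip_curvature_self[OF assms, of u v "w + z"] ip_curvature_self[OF assms, of u v w]
    ip_curvature_self[OF assms, of u v z]
  by (simp add: ip_linear curvature_linear[OF assms])

end

text \<open>The classical fact that sectional curvature determines the curvature tensor, in the form
  needed for the difference \<open>Q\<close> of two curvature-like tensors with equal sectional
  curvatures.\<close>

lemma algebraic_curvature_eq_zero:
  fixes Q :: "'a::real_vector \<Rightarrow> 'a \<Rightarrow> 'a \<Rightarrow> 'a \<Rightarrow> real"
  assumes anti1: "\<And>u v w z. Q u v w z = - Q v u w z"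
    and anti2: "\<And>u v w z. Q u v w z = - Q u v z w"
    and bianchi: "\<And>u v w z. Q u v w z + Q v w u z + Q w u v z = 0"
    and sec: "\<And>u v. Q u v v u = 0"
    and add1: "\<And>u u' v w z. Q (u + u') v w z = Q u v w z + Q u' v w z"
    and add2: "\<And>u v v' w z. Q u (v + v') w z = Q u v w z + Q u v' w z"
    and add3: "\<And>u v w w' z. Q u v (w + w') z = Q u v w z + Q u v w' z"
    and add4: "\<And>u v w z z'. Q u v w (z + z') = Q u v w z + Q u v w z'"
  shows "Q u v w z = 0"
proof -
  \<comment> \<open>Combines four Bianchi identities, each with a different argument in the last
    slot; by the sign rules all terms but the two compared cancel.\<close>
  have pair: "Q u v w z = Q w z u v" for u v w z
    using bianchi[of u v w z] bianchi[of v w z u] bianchi[of w z u v] bianchi[of z u v w]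
      anti2[of u v z w] anti2[of v w z u] anti1[of u w z v] anti2[of w u z v]
      anti2[of w z v u] anti2[of z u v w] anti1[of v z u w] anti2[of z v u w]
    by linarith
  have q1: "Q u v v z = 0" for u v z
  proof -
    have "Q u v v z + Q z v v u = 0"
      using sec[of "u + z" v] sec[of u v] sec[of z v] by (simp add: add1 add4)
    moreover have "Q z v v u = Q u v v z"
      using pair[of z v v u] anti1[of v u z v] anti2[of u v z v] by linarith
    ultimately show ?thesis by simp
  qed
  \<comment> \<open>After polarisation in the outer arguments (\<open>q1\<close>), this is
    polarisation in the middle ones. Now \<open>Q\<close> is alternating in its first three
    arguments, so the three Bianchi terms are equal and 3 Q = 0.\<close>
  have q2: "Q u v w z = - Q u w v z" for u v w z
    using q1[of u "v + w" z] q1[of u v z] q1[of u w z] by (simp add: add2 add3)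
  show ?thesis
    using bianchi[of u v w z] q2[of u v w z] anti1[of u v w z] q2[of v u w z] anti1[of w u v z]
       anti1[of v w u z] q2[of w v u z] q2[of w u v z]
    by linarith
qed

text \<open>The tensor on the right has the symmetries of a curvature tensor and sectional curvature
  \<open>c\<close>, so the algebraic lemma applies to the difference.\<close>

lemma (in metric_domain) constant_curvature:
  assumes x: "x \<in> V"
    and sec: "\<And>v w. v \<noteq> w \<Longrightarrow> independent {v, w} \<Longrightarrow> sectional_curvature h x v w = c"
  shows "curvature h x u v w = c *\<^sub>R (ip (h x) v w *\<^sub>R u - ip (h x) u w *\<^sub>R v)"
proof (rule ip_nondegenerate[OF x])
  fix z
  define Q where "Q u v w z = ip (h x) (curvature h x u v w) z -
      c * (ip (h x) v w * ip (h x) u z - ip (h x) u w * ip (h x) v z)" for u v w z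
  note Q_linear = ip_linear curvature_linear[OF x] algebra_simps
  \<comment> \<open>Linearly dependent pairs are not covered by \<open>sec\<close>; on them both
    parts of \<open>Q\<close> vanish.\<close>
  have scale: "Q (r *\<^sub>R v) v v (r *\<^sub>R v) = 0" "Q v (r *\<^sub>R v) (r *\<^sub>R v) v = 0" for r v
    by (simp_all add: Q_def Q_linear curvature_def[of h x v v])
  have "Q u v w z = 0"
  proof (rule algebraic_curvature_eq_zero[of Q])
    show "Q v w w v = 0" for v w
    proof (cases "v \<noteq> w \<and> independent {v, w}")
      case True
      \<comment> \<open>The vector a v - b w is \<open>a\<close> times the component of
        \<open>v\<close> orthogonal to \<open>w\<close>. Its squared length is \<open>a\<close>
        times the Gram determinant, which is therefore nonzero and can be cleared from
        \<open>sectional_curvature\<close>.\<close>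
      define a where "a = ip (h x) w w"
      define b where "b = ip (h x) v w"
      have "w \<noteq> 0" using True dependent_zero by blast
      then have "a > 0" unfolding a_def by (rule ip_pos[OF x])
      have "v \<notin> span {w}"
        using True by (simp add: independent_insert)
      then have "a *\<^sub>R v - b *\<^sub>R w \<noteq> 0"
      proof -
        have "v = inverse a *\<^sub>R (b *\<^sub>R w)" if "a *\<^sub>R v - b *\<^sub>R w = 0"
        proof -
          have "v = inverse a *\<^sub>R (a *\<^sub>R v)" using \<open>a > 0\<close> by simp
          also have "a *\<^sub>R v = b *\<^sub>R w" using that by simp
          finally show ?thesis .
        qed
        then show ?thesis using \<open>v \<notin> span {w}\<close> by (auto simp: span_base span_scale)
      qed
      then have "0 < ip (h x) (a *\<^sub>R v - b *\<^sub>R w) (a *\<^sub>R v - b *\<^sub>R w)"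
        by (rule ip_pos[OF x])
      also have "\<dots> = a * (ip (h x) v v * ip (h x) w w - (ip (h x) v w)\<^sup>2)"
        by (simp add: ip_linear ip_commute[OF x, of w v] a_def b_def power2_eq_square algebra_simps)
      finally have "ip (h x) v v * ip (h x) w w - (ip (h x) v w)\<^sup>2 \<noteq> 0"
        by auto
      then show ?thesis
        using sec[of v w] True
        by (simp add: sectional_curvature_def Q_def ip_commute[OF x, of w v] field_simps power2_eq_square)
    next
      case False
      then consider "v = w" | "w = 0" | "v \<in> span {w}"
        by (auto simp: independent_insert split: if_splits)
      then show ?thesis
      proof cases
        case 1
        then show ?thesis using scale(1)[of 1 w] by simp
      next
        case 2
        then show ?thesis using scale(2)[of v 0] by simp
      next
        case 3
        then show ?thesis using scale(1) by (auto simp: span_singleton)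
      qed
    qed
    show "Q u v w z = - Q v u w z" for u v w z
      using curvature_antisym[of x u v w] by (simp add: Q_def Q_linear)
    show "Q u v w z = - Q u v z w" for u v w z
      using ip_curvature_antisym[OF x, of u v w z] by (simp add: Q_def Q_linear)
    show "Q u v w z + Q v w u z + Q w u v z = 0" for u v w z
    proof -
      have "ip (h x) (curvature h x u v w) z + ip (h x) (curvature h x v w u) z + ip (h x) (curvature h x w u v) z = 0"
        using first_bianchi[OF x, of u v w] by (simp add: ip_add_left[symmetric] ip_zero_left)
      then show ?thesis
        by (simp add: Q_def ip_commute[OF x, of v u] ip_commute[OF x, of w u] ip_commute[OF x, of w v] algebra_simps)
    qed
  qed (simp_all add: Q_def Q_linear)
  then show "ip (h x) (curvature h x u v w) z = ip (h x) (c *\<^sub>R (ip (h x) v w *\<^sub>R u - ip (h x) u w *\<^sub>R v)) z"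
    by (simp add: Q_def ip_linear)
qed

section \<open>Vector fields along a map\<close>

text \<open>Product rule for a field of linear maps whose derivative is known on fixed vectors. The
  family \<open>L'\<close> is not assumed to be linear; its value at \<open>W x\<close> is
  identified by differentiating the coordinate expansion of \<open>L y (W x)\<close> and using
  uniqueness of derivatives.\<close>

lemma has_derivative_linear_apply:
  fixes W :: "'a::real_normed_vector \<Rightarrow> real^'n" and L :: "'a \<Rightarrow> real^'n \<Rightarrow> 'b::real_normed_vector"
  assumes S: "open S" "x \<in> S" and lin: "\<And>y. y \<in> S \<Longrightarrow> linear (L y)"
    and L: "\<And>v. ((\<lambda>y. L y v) has_derivative L' v) (at x)"
    and W: "(W has_derivative W') (at x)"
  shows "((\<lambda>y. L y (W y)) has_derivative (\<lambda>z. L' (W x) z + L x (W' z))) (at x)"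
proof -
  have expand: "L y v = (\<Sum>i\<in>UNIV. v $ i *\<^sub>R L y (axis i 1))" if "y \<in> S" for y v
    by (rule linear_axis_expansion[OF lin[OF that]])
  have "((\<lambda>y. \<Sum>i\<in>UNIV. W x $ i *\<^sub>R L y (axis i 1)) has_derivative
      (\<lambda>z. \<Sum>i\<in>UNIV. W x $ i *\<^sub>R L' (axis i 1) z)) (at x)"
    by (intro has_derivative_sum has_derivative_scaleR_right L)
  then have "((\<lambda>y. L y (W x)) has_derivative (\<lambda>z. \<Sum>i\<in>UNIV. W x $ i *\<^sub>R L' (axis i 1) z)) (at x)"
    by (rule has_derivative_transform_within_open[OF _ S]) (rule expand[symmetric])
  then have L'W: "L' (W x) = (\<lambda>z. \<Sum>i\<in>UNIV. W x $ i *\<^sub>R L' (axis i 1) z)"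
    by (rule has_derivative_unique[OF L])
  have "((\<lambda>y. \<Sum>i\<in>UNIV. W y $ i *\<^sub>R L y (axis i 1)) has_derivative
      (\<lambda>z. \<Sum>i\<in>UNIV. W x $ i *\<^sub>R L' (axis i 1) z + W' z $ i *\<^sub>R L x (axis i 1))) (at x)"
    by (intro has_derivative_sum has_derivative_scaleR L
        bounded_linear.has_derivative[OF bounded_linear_vec_nth] W)
  then have "((\<lambda>y. L y (W y)) has_derivative
      (\<lambda>z. \<Sum>i\<in>UNIV. W x $ i *\<^sub>R L' (axis i 1) z + W' z $ i *\<^sub>R L x (axis i 1))) (at x)"
    by (rule has_derivative_transform_within_open[OF _ S]) (rule expand[symmetric])
  then show ?thesis
    by (simp add: L'W sum.distrib expand[OF S(2), symmetric])
qed

locale metric_map = metric_domain V h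
  for V :: "(real^'n) set" and h :: "real^'n \<Rightarrow> real^'n^'n" +
  fixes U :: "(real^'m) set" and f :: "real^'m \<Rightarrow> real^'n"
  assumes open_source: "open U" and smooth_map: "smooth_on U f" and maps_into: "u \<in> U \<Longrightarrow> f u \<in> V"
begin

abbreviation cov :: "(real^'m \<Rightarrow> real^'n) \<Rightarrow> real^'m \<Rightarrow> real^'m \<Rightarrow> real^'n" where
  "cov \<equiv> cov_along h f"

abbreviation inn :: "real^'m \<Rightarrow> real^'n \<Rightarrow> real^'n \<Rightarrow> real" where
  "inn u \<equiv> ip (h (f u))"

lemmas inn_commute = ip_commute[OF maps_into]

lemma image_subset: "f ` U \<subseteq> V"
  using maps_into by blast

lemma has_derivative_map: "u \<in> U \<Longrightarrow> (f has_derivative der f u) (at u)"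
  using smooth_on_differentiable[OF smooth_map] has_derivative_der by blast

lemma linear_der_map: "u \<in> U \<Longrightarrow> linear (der f u)"
  by (rule linear_frechet_derivative) (rule smooth_on_differentiable[OF smooth_map])

lemma smooth_der_map: "smooth_on U (\<lambda>u. der f u X)"
  by (rule smooth_on_der[OF open_source smooth_map])

text \<open>The base point and both slots vary: starting from the chain rule through
  \<open>f\<close> for fixed vectors, the product rule for linear families is applied once for each
  slot.\<close>

lemma has_derivative_christoffel_map:
  assumes u: "u \<in> U"
    and A: "(A has_derivative A') (at u)" and B: "(B has_derivative B') (at u)"
  shows "((\<lambda>y. christoffel h (f y) (A y) (B y)) has_derivative
    (\<lambda>z. der (\<lambda>p. christoffel h p (A u) (B u)) (f u) (der f u z) +
         christoffel h (f u) (A' z) (B u) + christoffel h (f u) (A u) (B' z))) (at u)"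
proof -
  have D: "((\<lambda>y. christoffel h (f y) a b) has_derivative (\<lambda>z. der (\<lambda>p. christoffel h p a b) (f u) (der f u z))) (at u)"
    for a b
    by (rule has_derivative_compose[OF has_derivative_map[OF u]
          has_derivative_der[OF differentiable_christoffel[OF maps_into[OF u]]]])
  have DA: "((\<lambda>y. christoffel h (f y) (A y) b) has_derivative
      (\<lambda>z. der (\<lambda>p. christoffel h p (A u) b) (f u) (der f u z) + christoffel h (f u) (A' z) b)) (at u)" for b
    by (rule has_derivative_linear_apply[OF open_source u, where L = "\<lambda>y v. christoffel h (f y) v b"])
       (rule linear_christoffel_left[OF maps_into], assumption, rule D, rule A)
  show ?thesis
    by (rule has_derivative_linear_apply[OF open_source u, where L = "\<lambda>y v. christoffel h (f y) (A y) v"])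
       (rule linear_christoffel_right[OF maps_into], assumption, rule DA, rule B)
qed

lemma smooth_christoffel_map:
  assumes "smooth_on U A" "smooth_on U B"
  shows "smooth_on U (\<lambda>u. christoffel h (f u) (A u) (B u))"
proof -
  have S: "smooth_on U (\<lambda>u. christoffel h (f u) a b)" for a b
    by (rule smooth_on_compose[OF open_source open_dom image_subset smooth_map smooth_christoffel])
  have SA: "smooth_on U (\<lambda>u. christoffel h (f u) (A u) b)" for b
    by (rule smooth_on_linear_apply[OF open_source assms(1), where L = "\<lambda>u v. christoffel h (f u) v b"])
       (rule S, rule linear_christoffel_left[OF maps_into])
  show ?thesis
    by (rule smooth_on_linear_apply[OF open_source assms(2), where L = "\<lambda>u v. christoffel h (f u) (A u) v"])
       (rule SA, rule linear_christoffel_right[OF maps_into])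
qed

lemma smooth_cov: "smooth_on U W \<Longrightarrow> smooth_on U (\<lambda>u. cov W u X)"
  unfolding cov_along_def
  by (rule smooth_on_add[OF open_source smooth_on_der[OF open_source] smooth_christoffel_map[OF smooth_der_map]])

lemma smooth_inn: "smooth_on U A \<Longrightarrow> smooth_on U B \<Longrightarrow> smooth_on U (\<lambda>u. inn u (A u) (B u))"
  by (rule smooth_on_ip[OF open_source smooth_on_compose[OF open_source open_dom image_subset smooth_map smooth_metric]])

lemma cov_cong:
  assumes "u \<in> U" "\<And>y. y \<in> U \<Longrightarrow> A y = B y"
  shows "cov A u X = cov B u X"
  unfolding cov_along_def using der_cong_open[OF open_source assms(1), of A B] assms by simp

lemma cov_zero: "u \<in> U \<Longrightarrow> cov (\<lambda>u. 0) u X = 0"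
  by (simp add: cov_along_def christoffel_linear[OF maps_into])

lemma cov_add:
  assumes u: "u \<in> U" and "A differentiable (at u)" "B differentiable (at u)"
  shows "cov (\<lambda>u. A u + B u) u X = cov A u X + cov B u X"
  using der_eqI[OF has_derivative_add[OF assms(2,3)[THEN has_derivative_der]], of X]
  by (simp add: cov_along_def christoffel_linear[OF maps_into[OF u]])

lemma cov_scaleR:
  fixes r :: "real^'m \<Rightarrow> real"
  assumes u: "u \<in> U" and "r differentiable (at u)" "A differentiable (at u)"
  shows "cov (\<lambda>u. r u *\<^sub>R A u) u X = der r u X *\<^sub>R A u + r u *\<^sub>R cov A u X"
  using der_eqI[OF has_derivative_scaleR[OF assms(2,3)[THEN has_derivative_der]], of X]
  by (simp add: cov_along_def christoffel_linear[OF maps_into[OF u]] scaleR_add_right)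

lemma linear_cov:
  assumes "u \<in> U" "A differentiable (at u)"
  shows "linear (cov A u)"
  by (rule linearI)
     (simp_all add: cov_along_def linear_add[OF linear_der_map[OF assms(1)]] linear_cmul[OF linear_der_map[OF assms(1)]]
        linear_add[OF linear_frechet_derivative[OF assms(2)]] linear_cmul[OF linear_frechet_derivative[OF assms(2)]]
        christoffel_linear[OF maps_into[OF assms(1)]] scaleR_add_right)

text \<open>Compatibility of the connection with the metric \<open>h\<close>, pulled back along
  \<open>f\<close>.\<close>

lemma der_inn:
  assumes u: "u \<in> U" and A: "A differentiable (at u)" and B: "B differentiable (at u)"
  shows "der (\<lambda>u. inn u (A u) (B u)) u X = inn u (cov A u X) (B u) + inn u (A u) (cov B u X)"
proof -
  have "((\<lambda>u. h (f u)) has_derivative (\<lambda>z. der h (f u) (der f u z))) (at u)"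
    by (rule has_derivative_compose[OF has_derivative_map[OF u] has_derivative_metric[OF maps_into[OF u]]])
  from der_eqI[OF has_derivative_ip[OF this A[THEN has_derivative_der] B[THEN has_derivative_der]], of X]
  show ?thesis
    by (simp add: cov_along_def metric_compatible[OF maps_into[OF u]] ip_linear)
qed

text \<open>The pulled-back connection is torsion-free on commuting fields: second derivatives of
  \<open>f\<close> commute and \<open>christoffel\<close> is symmetric.\<close>

lemma cov_der_commute:
  assumes "u \<in> U"
  shows "cov (\<lambda>u. der f u Y) u X = cov (\<lambda>u. der f u X) u Y"
  using der_der_commute[OF open_source smooth_map assms, of Y X]
    christoffel_commute[OF maps_into[OF assms], of "der f u X" "der f u Y"]
  by (simp add: cov_along_def)

text \<open>No bracket term occurs since the coordinate fields \<open>X\<close> and \<open>Y\<close>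
  commute. The mixed second derivatives of \<open>W\<close> and of \<open>f\<close> cancel, and what
  is left is the definition of \<open>curvature\<close> at \<open>f u\<close>. The Codazzi and Ricci
  equations are all read off from this identity.\<close>

lemma cov_cov:
  assumes u: "u \<in> U" and W: "smooth_on U W"
  shows "cov (\<lambda>u. cov W u Y) u X - cov (\<lambda>u. cov W u X) u Y =
    curvature h (f u) (der f u X) (der f u Y) (W u)"
proof -
  have D: "((\<lambda>u. der F u Y) has_derivative der (\<lambda>u. der F u Y) u) (at u)" if "smooth_on U F"
    for F :: "real^'m \<Rightarrow> real^'n" and Y
    by (rule has_derivative_der[OF smooth_on_differentiable[OF smooth_on_der[OF open_source that] u]])
  have DW: "(W has_derivative der W u) (at u)"
    by (rule has_derivative_der[OF smooth_on_differentiable[OF W u]])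
  have expand: "der (\<lambda>u. cov W u Y) u X = der (\<lambda>u. der W u Y) u X +
      (der (\<lambda>p. christoffel h p (der f u Y) (W u)) (f u) (der f u X) +
       christoffel h (f u) (der (\<lambda>u. der f u Y) u X) (W u) + christoffel h (f u) (der f u Y) (der W u X))" for X Y
    unfolding cov_along_def
    by (rule der_eqI) (rule has_derivative_add[OF D[OF W] has_derivative_christoffel_map[OF u D[OF smooth_map] DW]])
  show ?thesis
    unfolding cov_along_def[of h f "\<lambda>u. cov_along h f W u _"] expand
    unfolding cov_along_def curvature_def
    using der_der_commute[OF open_source W u, of Y X] der_der_commute[OF open_source smooth_map u, of Y X]
    by (simp add: christoffel_linear[OF maps_into[OF u]])
qed

end

section \<open>Metric traces\<close>

text \<open>Values in a real vector space, so that the same contraction with the inverse metric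
  serves for the vector \<open>mean_curvature\<close> and for scalar forms such as those in
  \<open>divergence\<close>.\<close>

definition trace_form :: "real^'n^'n \<Rightarrow> (real^'n \<Rightarrow> real^'n \<Rightarrow> 'b::real_vector) \<Rightarrow> 'b" where
  "trace_form A F = (\<Sum>a\<in>UNIV. \<Sum>b\<in>UNIV. (matrix_inv A $ a $ b) *\<^sub>R F (axis a 1) (axis b 1))"

lemma linear_trace_form:
  assumes "linear L"
  shows "L (trace_form A F) = trace_form A (\<lambda>v w. L (F v w))"
  by (simp add: trace_form_def linear_sum[OF assms] linear_cmul[OF assms])

lemma trace_form_add: "trace_form A (\<lambda>v w. F v w + G v w) = trace_form A F + trace_form A G"
  by (simp add: trace_form_def scaleR_add_right sum.distrib)

lemma trace_form_diff: "trace_form A (\<lambda>v w. F v w - G v w) = trace_form A F - trace_form A G"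
  by (simp add: trace_form_def scaleR_diff_right sum_subtractf)

context metric_domain
begin

text \<open>The gradient of the \<open>a\<close>-th coordinate function. Paired with
  \<open>axis a 1\<close> it absorbs the inverse matrix, which turns traces into single sums that
  the product rule can differentiate.\<close>

definition dual :: "real^'n \<Rightarrow> 'n \<Rightarrow> real^'n" where
  "dual x a = matrix_inv (h x) *v axis a 1"

lemma dual_component: "dual x b $ a = matrix_inv (h x) $ a $ b"
  by (simp add: dual_def matrix_vector_mult_basis column_def)

lemma ip_dual: "x \<in> V \<Longrightarrow> ip (h x) (dual x a) w = w $ a"
  by (simp add: dual_def ip_matrix_inv inner_axis')

lemma smooth_dual: "smooth_on V (\<lambda>x. dual x a)"
  unfolding dual_def
  by (rule smooth_on_matrix_inv_apply[OF open_dom smooth_metric invertible_metric smooth_on_const])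

lemma trace_form_dual:
  assumes "\<And>w. linear (\<lambda>v. F v w)"
  shows "trace_form (h x) F = (\<Sum>a\<in>UNIV. F (dual x a) (axis a 1))"
proof -
  have "trace_form (h x) F = (\<Sum>b\<in>UNIV. \<Sum>a\<in>UNIV. dual x b $ a *\<^sub>R F (axis a 1) (axis b 1))"
    unfolding trace_form_def dual_component by (rule sum.swap)
  also have "\<dots> = (\<Sum>b\<in>UNIV. F (dual x b) (axis b 1))"
    by (rule sum.cong[OF refl]) (rule linear_axis_expansion[OF assms, symmetric])
  finally show ?thesis .
qed

text \<open>Pairwise orthogonal nonzero vectors are independent, and as many of them as the
  dimension span the space, so \<open>w\<close> is orthogonal to itself.\<close>

lemma orthogonal_family_nondegenerate:
  assumes x: "x \<in> V" and S: "finite S" "card S = CARD('n)"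
    and nz: "\<And>s. s \<in> S \<Longrightarrow> s \<noteq> 0"
    and orth: "\<And>s t. s \<in> S \<Longrightarrow> t \<in> S \<Longrightarrow> s \<noteq> t \<Longrightarrow> ip (h x) s t = 0"
    and w: "\<And>s. s \<in> S \<Longrightarrow> ip (h x) w s = 0"
  shows "w = 0"
proof -
  have vanish: "ip (h x) v t = 0" if "t \<in> span T" "\<And>s. s \<in> T \<Longrightarrow> ip (h x) v s = 0" for v t T
    using linear_eq_0_on_span[OF linear_ip_right that(2) that(1)] .
  have "independent S"
  proof
    assume "dependent S"
    then obtain s where s: "s \<in> S" "s \<in> span (S - {s})"
      by (auto simp: dependent_def)
    then have "ip (h x) s s = 0"
      by (intro vanish[OF s(2)]) (auto intro: orth)
    then show False using ip_eq_zero_iff[OF x] nz s(1) by blast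
  qed
  then have "span S = UNIV"
    using card_ge_dim_independent[of S UNIV] S by auto
  then have "ip (h x) w w = 0"
    by (intro vanish[of w S] w) auto
  then show ?thesis using ip_eq_zero_iff[OF x] by simp
qed

text \<open>Traces commute with covariant differentiation because the metric is parallel.\<close>

lemma der_trace_form:
  fixes b :: "real^'n \<Rightarrow> real^'n \<Rightarrow> real^'n \<Rightarrow> real"
  assumes x: "x \<in> V"
    and lin1: "\<And>y w. y \<in> V \<Longrightarrow> linear (\<lambda>v. b y v w)"
    and lin2: "\<And>y v. y \<in> V \<Longrightarrow> linear (b y v)"
    and diff: "\<And>v w. (\<lambda>y. b y v w) differentiable (at x)"
  shows "der (\<lambda>y. trace_form (h y) (b y)) x z = trace_form (h x) (cov_deriv_form h b x z)"
proof -
  note D = has_derivative_der[OF diff]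
  define dual' where "dual' a = der (\<lambda>y. dual y a) x z" for a
  have Ddual: "((\<lambda>y. dual y a) has_derivative der (\<lambda>y. dual y a) x) (at x)" for a
    by (rule has_derivative_der[OF smooth_on_differentiable[OF smooth_dual x]])
  \<comment> \<open>Comes from differentiating the constant
    \<open>ip (h y) (dual y a) w = w $ a\<close>. The first term yields the Christoffel correction
    in the first slot of \<open>b\<close>; the sum over \<open>d\<close> yields the one in the
    second slot, once the summations are interchanged.\<close>
  have dual': "dual' a = - christoffel h x z (dual x a) - (\<Sum>d\<in>UNIV. christoffel h x z (axis d 1) $ a *\<^sub>R dual x d)" for a
  proof (rule ip_nondegenerate[OF x])
    fix w
    have "der (\<lambda>y. ip (h y) (dual y a) w) x = der (\<lambda>y. w $ a) x"
      by (rule der_cong_open[OF open_dom x]) (rule ip_dual)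
    then have "ip (der h x z) (dual x a) w + ip (h x) (dual' a) w = 0"
      using der_eqI[OF has_derivative_ip[OF has_derivative_metric[OF x] Ddual has_derivative_const], of a w z]
      by (simp add: ip_linear dual'_def)
    then have eq: "ip (h x) (dual' a) w = - ip (h x) (christoffel h x z (dual x a)) w - christoffel h x z w $ a"
      by (simp add: metric_compatible[OF x] ip_dual[OF x])
    have "linear (\<lambda>w. christoffel h x z w $ a)"
      by (rule linearI) (simp_all add: christoffel_linear[OF x])
    from linear_axis_expansion[OF this, of w]
    have "christoffel h x z w $ a = (\<Sum>d\<in>UNIV. w $ d * christoffel h x z (axis d 1) $ a)"
      by simp
    with eq show "ip (h x) (dual' a) w = ip (h x) (- christoffel h x z (dual x a) -
        (\<Sum>d\<in>UNIV. christoffel h x z (axis d 1) $ a *\<^sub>R dual x d)) w"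
      by (simp add: ip_diff_left ip_minus_left ip_sum_left ip_scaleR_left ip_dual[OF x] mult.commute)
  qed
  have sum_dual': "(\<Sum>a\<in>UNIV. b x (dual' a) (axis a 1)) =
      - (\<Sum>a\<in>UNIV. b x (christoffel h x z (dual x a)) (axis a 1)) - (\<Sum>d\<in>UNIV. b x (dual x d) (christoffel h x z (axis d 1)))"
  proof -
    have "(\<Sum>a\<in>UNIV. \<Sum>d\<in>UNIV. christoffel h x z (axis d 1) $ a * b x (dual x d) (axis a 1)) =
       (\<Sum>d\<in>UNIV. \<Sum>a\<in>UNIV. christoffel h x z (axis d 1) $ a * b x (dual x d) (axis a 1))"
      by (rule sum.swap)
    also have "\<dots> = (\<Sum>d\<in>UNIV. b x (dual x d) (christoffel h x z (axis d 1)))"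
      using linear_axis_expansion[OF lin2[OF x], symmetric] by simp
    finally show ?thesis
      by (simp add: dual' linear_diff[OF lin1[OF x]] linear_neg[OF lin1[OF x]] linear_sum[OF lin1[OF x]]
          linear_cmul[OF lin1[OF x]] sum_subtractf sum_negf)
  qed
  have lin_der: "linear (\<lambda>v. der (\<lambda>y. b y v w) x z)" for w
  proof (rule linearI)
    fix v v' r
    have "der (\<lambda>y. b y (v + v') w) x = der (\<lambda>y. b y v w + b y v' w) x"
      by (rule der_cong_open[OF open_dom x]) (simp add: linear_add[OF lin1])
    then show "der (\<lambda>y. b y (v + v') w) x z = der (\<lambda>y. b y v w) x z + der (\<lambda>y. b y v' w) x z"
      using der_eqI[OF has_derivative_add[OF D D]] by simp
    have "der (\<lambda>y. b y (r *\<^sub>R v) w) x = der (\<lambda>y. r *\<^sub>R b y v w) x"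
      by (rule der_cong_open[OF open_dom x]) (simp add: linear_cmul[OF lin1])
    then show "der (\<lambda>y. b y (r *\<^sub>R v) w) x z = r *\<^sub>R der (\<lambda>y. b y v w) x z"
      using der_eqI[OF has_derivative_scaleR_right[OF D]] by simp
  qed
  have D_summand: "((\<lambda>y. b y (dual y a) (axis a 1)) has_derivative
      (\<lambda>z. der (\<lambda>y. b y (dual x a) (axis a 1)) x z + b x (der (\<lambda>y. dual y a) x z) (axis a 1))) (at x)" for a
    by (rule has_derivative_linear_apply[OF open_dom x, where L = "\<lambda>y v. b y v (axis a 1)"])
       (rule lin1, assumption, rule D, rule Ddual)
  have D_sum: "((\<lambda>y. \<Sum>a\<in>UNIV. b y (dual y a) (axis a 1)) has_derivative
      (\<lambda>z. \<Sum>a\<in>UNIV. der (\<lambda>y. b y (dual x a) (axis a 1)) x z + b x (der (\<lambda>y. dual y a) x z) (axis a 1))) (at x)"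
    by (rule has_derivative_sum) (rule D_summand)
  have "linear (\<lambda>v. cov_deriv_form h b x z v w)" for w
    unfolding cov_deriv_form_def
    by (rule linearI)
       (simp_all add: linear_add[OF lin_der] linear_cmul[OF lin_der] christoffel_linear[OF x]
          linear_add[OF lin1[OF x]] linear_cmul[OF lin1[OF x]] algebra_simps)
  then have "trace_form (h x) (cov_deriv_form h b x z) =
      (\<Sum>a\<in>UNIV. der (\<lambda>y. b y (dual x a) (axis a 1)) x z) + (\<Sum>a\<in>UNIV. b x (dual' a) (axis a 1))"
    unfolding sum_dual' by (simp add: trace_form_dual cov_deriv_form_def sum_subtractf)
  also have "\<dots> = (\<Sum>a\<in>UNIV. der (\<lambda>y. b y (dual x a) (axis a 1)) x z + b x (dual' a) (axis a 1))"
    by (simp add: sum.distrib)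
  also have "\<dots> = der (\<lambda>y. \<Sum>a\<in>UNIV. b y (dual y a) (axis a 1)) x z"
    using der_eqI[OF D_sum, of z] by (simp add: dual'_def)
  also have "der (\<lambda>y. \<Sum>a\<in>UNIV. b y (dual y a) (axis a 1)) x = der (\<lambda>y. trace_form (h y) (b y)) x"
    by (rule der_cong_open[OF open_dom x]) (simp add: trace_form_dual[OF lin1])
  finally show ?thesis ..
qed

end

section \<open>Orthonormal bases in dimension two\<close>

locale metric_plane = metric_domain V h for V :: "(real^2) set" and h :: "real^2 \<Rightarrow> real^2^2"
begin

lemma orthonormal_expansion:
  assumes x: "x \<in> V" and p: "ip (h x) p p = 1" and q: "ip (h x) q q = 1" and pq: "ip (h x) p q = 0"
  shows "w = ip (h x) w p *\<^sub>R p + ip (h x) w q *\<^sub>R q"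
proof -
  have "p \<noteq> q" using p pq by auto
  have "p \<noteq> 0" "q \<noteq> 0" using p q by (auto simp: ip_zero_left)
  have "w - (ip (h x) w p *\<^sub>R p + ip (h x) w q *\<^sub>R q) = 0"
    by (rule orthogonal_family_nondegenerate[OF x, of "{p, q}"])
       (use \<open>p \<noteq> q\<close> \<open>p \<noteq> 0\<close> \<open>q \<noteq> 0\<close> p q pq ip_commute[OF x, of q p] in \<open>auto simp: ip_linear\<close>)
  then show ?thesis by simp
qed

text \<open>In the basis \<open>p\<close>, \<open>q\<close> the vector \<open>dual x a\<close> has
  the components \<open>p $ a\<close> and \<open>q $ a\<close>, so the sum over \<open>a\<close>
  reassembles \<open>p\<close> and \<open>q\<close> in the second slot.\<close>

lemma trace_form_orthonormal:
  assumes x: "x \<in> V" and p: "ip (h x) p p = 1" and q: "ip (h x) q q = 1" and pq: "ip (h x) p q = 0"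
    and F1: "\<And>w. linear (\<lambda>v. F v w)" and F2: "\<And>v. linear (F v)"
  shows "trace_form (h x) F = F p p + F q q"
proof -
  have "F (dual x a) w = p $ a *\<^sub>R F p w + q $ a *\<^sub>R F q w" for a w
  proof -
    have "dual x a = p $ a *\<^sub>R p + q $ a *\<^sub>R q"
      using orthonormal_expansion[OF x p q pq, of "dual x a"] by (simp add: ip_dual[OF x])
    then show ?thesis
      by (simp add: linear_add[OF F1] linear_cmul[OF F1])
  qed
  then have "trace_form (h x) F =
      (\<Sum>a\<in>UNIV. p $ a *\<^sub>R F p (axis a 1)) + (\<Sum>a\<in>UNIV. q $ a *\<^sub>R F q (axis a 1))"
    by (simp add: trace_form_dual[OF F1] sum.distrib)
  then show ?thesis
    using linear_axis_expansion[OF F2, of p p] linear_axis_expansion[OF F2, of q q] by simp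
qed

lemma orthonormal_completion:
  assumes x: "x \<in> V" and p: "ip (h x) p p = 1"
  obtains q where "ip (h x) q q = 1" "ip (h x) p q = 0"
proof -
  define a where "a = h x *v p"
  \<comment> \<open>The quarter turn of \<open>a\<close> is Euclidean-orthogonal to
    \<open>a\<close>, that is, orthogonal to \<open>p\<close> in the metric
    \<open>h x\<close>.\<close>
  define r where "r = (vector [- a $ 2, a $ 1] :: real^2)"
  have pr: "ip (h x) p r = 0"
    unfolding ip_commute[OF x, of p r]
    by (simp add: ip_def a_def[symmetric] r_def inner_vec_def sum_2)
  have "r \<noteq> 0"
  proof
    assume "r = 0"
    then have "r $ 1 = 0" "r $ 2 = 0" by simp_all
    then have "a = 0" by (simp add: r_def vec_eq_iff forall_2)
    then show False using p by (simp add: ip_def a_def)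
  qed
  then have pos: "ip (h x) r r > 0" by (rule ip_pos[OF x])
  show thesis
  proof
    show "ip (h x) ((1 / sqrt (ip (h x) r r)) *\<^sub>R r) ((1 / sqrt (ip (h x) r r)) *\<^sub>R r) = 1"
      using pos by (simp add: ip_linear)
    show "ip (h x) p ((1 / sqrt (ip (h x) r r)) *\<^sub>R r) = 0"
      using pr by (simp add: ip_linear)
  qed
qed

end

section \<open>Isometric immersions of surfaces\<close>

locale immersed_surface = metric_map V h U f + dom: metric_plane U g
  for V :: "(real^'n) set" and h and U :: "(real^2) set" and f g +
  assumes isometric: "u \<in> U \<Longrightarrow> ip (h (f u)) (der f u X) (der f u Y) = ip (g u) X Y"
begin

abbreviation B :: "real^2 \<Rightarrow> real^2 \<Rightarrow> real^2 \<Rightarrow> real^'n" where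
  "B \<equiv> second_ff g h f"

abbreviation H :: "real^2 \<Rightarrow> real^'n" where
  "H \<equiv> mean_curvature g h f"

lemmas der_map_linear =
  linear_add[OF linear_der_map] linear_cmul[OF linear_der_map] linear_diff[OF linear_der_map]
  linear_0[OF linear_der_map]

lemma differentiable_der_map: "u \<in> U \<Longrightarrow> (\<lambda>u. der f u Y) differentiable (at u)"
  by (rule smooth_on_differentiable[OF smooth_der_map])

lemma linear_cov_der: "u \<in> U \<Longrightarrow> linear (cov (\<lambda>u. der f u Y) u)"
  by (rule linear_cov) (auto intro: differentiable_der_map)

lemma linear_cov_der': "u \<in> U \<Longrightarrow> linear (\<lambda>Y. cov (\<lambda>u. der f u Y) u X)"
  using linear_cov_der[of u X] ext[of "cov (\<lambda>u. der f u X) u", OF cov_der_commute[of u X]] by metis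

text \<open>The uniqueness argument for the Levi-Civita connection: by isometry the derivatives of
  \<open>g\<close> are those of ambient inner products of coordinate tangent fields, and
  \<open>cov_der_commute\<close> turns their Koszul combination into twice the left-hand side. So
  the tangential part of the ambient derivative is the intrinsic one.\<close>

lemma inn_cov_der:
  assumes u: "u \<in> U"
  shows "inn u (cov (\<lambda>u. der f u Y) u X) (der f u Z) = ip (g u) (christoffel g u X Y) Z"
proof -
  have der_g: "ip (der g u X) Y Z = inn u (cov (\<lambda>u. der f u Y) u X) (der f u Z) + inn u (cov (\<lambda>u. der f u Z) u X) (der f u Y)"
    for X Y Z
  proof -
    have "der (\<lambda>u. ip (g u) Y Z) u = der (\<lambda>u. inn u (der f u Y) (der f u Z)) u"
      by (rule der_cong_open[OF open_source u]) (rule isometric[symmetric])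
    from fun_cong[OF this, of X] show ?thesis
      using der_inn[OF u differentiable_der_map[OF u] differentiable_der_map[OF u], of Y Z X]
      by (simp add: dom.der_ip_const[OF u] inn_commute[OF u, of "der f u Y"])
  qed
  show ?thesis
    using dom.koszul[OF u, of X Y Z] der_g[of X Y Z] der_g[of Y X Z] der_g[of Z X Y]
      cov_der_commute[OF u, of X Y] cov_der_commute[OF u, of X Z] cov_der_commute[OF u, of Y Z]
    by simp
qed

lemma second_ff_normal:
  assumes "u \<in> U"
  shows "inn u (B u X Y) (der f u Z) = 0"
  by (simp add: second_ff_def ip_diff_left inn_cov_der[OF assms] isometric[OF assms])

lemma second_ff_commute:
  assumes "u \<in> U"
  shows "B u X Y = B u Y X"
  by (simp add: second_ff_def cov_der_commute[OF assms, of Y X] dom.christoffel_commute[OF assms, of X Y])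

lemma linear_second_ff_right:
  assumes "u \<in> U"
  shows "linear (B u X)"
  by (rule linearI)
     (simp_all add: second_ff_def linear_add[OF linear_cov_der'[OF assms]] linear_cmul[OF linear_cov_der'[OF assms]]
        dom.christoffel_linear[OF assms] der_map_linear[OF assms] scaleR_diff_right)

lemma linear_second_ff_left:
  assumes "u \<in> U"
  shows "linear (\<lambda>X. B u X Y)"
  using linear_second_ff_right[OF assms, of Y] unfolding second_ff_commute[OF assms, of Y] .

lemma linear_inn_second_ff_right: "u \<in> U \<Longrightarrow> linear (\<lambda>Y. inn u (B u X Y) \<xi>)"
  by (rule linear_compose[OF linear_second_ff_right linear_ip_left, unfolded o_def])

lemma linear_inn_second_ff_left: "u \<in> U \<Longrightarrow> linear (\<lambda>X. inn u (B u X Y) \<xi>)"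
  by (rule linear_compose[OF linear_second_ff_left linear_ip_left, unfolded o_def])

lemma smooth_der_map_apply: "smooth_on U T \<Longrightarrow> smooth_on U (\<lambda>u. der f u (T u))"
  by (rule smooth_on_linear_apply[OF open_source, where L = "\<lambda>u. der f u"])
     (auto intro: smooth_der_map linear_der_map)

lemma smooth_second_ff: "smooth_on U (\<lambda>u. B u X Y)"
  unfolding second_ff_def
  by (rule smooth_on_diff[OF open_source smooth_cov[OF smooth_der_map] smooth_der_map_apply[OF dom.smooth_christoffel]])

lemma mean_curvature_trace: "H u = (1/2) *\<^sub>R trace_form (g u) (B u)"
  by (simp add: mean_curvature_def trace_form_def)

lemma smooth_mean_curvature: "smooth_on U H"
proof -
  have "smooth_on U (\<lambda>u. dom.dual u b $ a)" for a b
    by (rule smooth_on_vec_nth[OF open_source dom.smooth_dual])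
  then have "smooth_on U (\<lambda>u. matrix_inv (g u) $ a $ b)" for a b
    by (simp add: dom.dual_component)
  then show ?thesis
    unfolding mean_curvature_def
    by (intro smooth_on_scaleR[OF open_source] smooth_on_sum[OF open_source] smooth_on_const smooth_second_ff)
qed

lemma trace_second_ff: "trace_form (g u) (\<lambda>X Y. inn u (B u X Y) \<xi>) = 2 * inn u (H u) \<xi>"
  using linear_trace_form[OF linear_ip_left[of "h (f u)" \<xi>], of "g u" "B u"]
  by (simp add: mean_curvature_trace ip_scaleR_left)

lemma mean_curvature_normal:
  assumes "u \<in> U"
  shows "inn u (H u) (der f u Z) = 0"
  using trace_second_ff[of u "der f u Z"] by (simp add: second_ff_normal[OF assms] trace_form_def)

lemma inn_second_ff:
  assumes u: "u \<in> U" and \<xi>: "\<And>Z. inn u \<xi> (der f u Z) = 0"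
  shows "inn u (B u X Y) \<xi> = inn u (cov (\<lambda>u. der f u Y) u X) \<xi>"
  using \<xi> inn_commute[OF u, of \<xi>] by (simp add: second_ff_def ip_diff_left)

text \<open>Obtained by differentiating the orthogonality of \<open>\<xi>\<close> and
  \<open>der f u Y\<close> along \<open>X\<close>.\<close>

lemma weingarten:
  assumes u: "u \<in> U" and \<xi>: "smooth_on U \<xi>" and normal: "\<And>u Z. u \<in> U \<Longrightarrow> inn u (\<xi> u) (der f u Z) = 0"
  shows "inn u (cov \<xi> u X) (der f u Y) = - inn u (B u X Y) (\<xi> u)"
proof -
  have "der (\<lambda>u. inn u (\<xi> u) (der f u Y)) u = der (\<lambda>u. 0) u"
    by (rule der_cong_open[OF open_source u]) (rule normal)
  then show ?thesis
    using der_inn[OF u smooth_on_differentiable[OF \<xi> u] differentiable_der_map[OF u], of Y X]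
    by (simp add: inn_second_ff[OF u normal[OF u]] inn_commute[OF u, of "\<xi> u"])
qed

text \<open>Justifies the description operator in \<open>shape_operator\<close>: inverting the
  metric gives a representing vector, and nondegeneracy makes it unique.\<close>

lemma ip_shape_operator:
  assumes u: "u \<in> U"
  shows "ip (g u) (shape_operator g h f u \<xi> X) Y = inn u (B u X Y) \<xi>"
proof -
  define Z where "Z = matrix_inv (g u) *v (\<chi> a. inn u (B u X (axis a 1)) \<xi>)"
  have Z: "ip (g u) Z Y = inn u (B u X Y) \<xi>" for Y
  proof -
    have "ip (g u) Z Y = (\<Sum>a\<in>UNIV. Y $ a *\<^sub>R inn u (B u X (axis a 1)) \<xi>)"
      by (simp add: Z_def dom.ip_matrix_inv[OF u] inner_vec_def mult.commute)
    then show ?thesis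
      using linear_axis_expansion[OF linear_inn_second_ff_right[OF u, of X \<xi>], of Y] by simp
  qed
  have "shape_operator g h f u \<xi> X = Z"
    unfolding shape_operator_def
    by (rule the_equality) (auto simp: Z intro: dom.ip_nondegenerate[OF u])
  then show ?thesis by (simp add: Z)
qed

lemma normal_part_normal:
  assumes u: "u \<in> U"
  shows "inn u (normal_part g h f u v) (der f u Z) = 0"
proof -
  have "linear (\<lambda>Z. inn u v (der f u Z))"
    by (rule linear_compose[OF linear_der_map[OF u] linear_ip_right, unfolded o_def])
  from linear_axis_expansion[OF this, of Z]
  show ?thesis
    by (simp add: normal_part_def ip_diff_left isometric[OF u] dom.ip_matrix_inv[OF u] inner_vec_def mult.commute)
qed

lemma inn_normal_part:
  assumes u: "u \<in> U" and \<xi>: "\<And>Z. inn u \<xi> (der f u Z) = 0"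
  shows "inn u (normal_part g h f u v) \<xi> = inn u v \<xi>"
  using \<xi> inn_commute[OF u, of \<xi>] by (simp add: normal_part_def ip_diff_left)

lemma smooth_normal_part:
  assumes "smooth_on U \<xi>"
  shows "smooth_on U (\<lambda>u. normal_part g h f u (\<xi> u))"
  unfolding normal_part_def
  by (intro smooth_on_diff[OF open_source] smooth_der_map_apply assms
      smooth_on_matrix_inv_apply[OF open_source dom.smooth_metric dom.invertible_metric]
      smooth_on_vec_lambda[OF open_source] smooth_inn smooth_der_map)

section \<open>The divergence of the stress-bienergy tensor\<close>

text \<open>\<open>B u Y Z\<close> is expressed by D_Z df(Y) rather than D_Y df(Z), so that
  exchanging \<open>X\<close> and \<open>Z\<close> changes the leading term exactly by ambient
  curvature. The three Christoffel terms are jointly invariant under this exchange, which leaves the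
  term with \<open>cov \<xi> u X\<close> as the other source of asymmetry.\<close>

lemma cov_deriv_second_ff:
  assumes u: "u \<in> U" and \<xi>: "smooth_on U \<xi>" and normal: "\<And>u Z. u \<in> U \<Longrightarrow> inn u (\<xi> u) (der f u Z) = 0"
  shows "cov_deriv_form g (\<lambda>u X Y. inn u (B u X Y) (\<xi> u)) u X Y Z =
    inn u (cov (\<lambda>u. cov (\<lambda>u. der f u Y) u Z) u X) (\<xi> u) + inn u (B u Z Y) (cov \<xi> u X)
    - inn u (B u X (christoffel g u Z Y)) (\<xi> u) - inn u (B u Z (christoffel g u X Y)) (\<xi> u)
    - inn u (B u Y (christoffel g u X Z)) (\<xi> u)"
proof -
  have smooth_DY: "smooth_on U (\<lambda>u. cov (\<lambda>u. der f u Y) u Z)"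
    by (rule smooth_cov[OF smooth_der_map])
  have "inn u (B u Y Z) (\<xi> u) = inn u (cov (\<lambda>u. der f u Y) u Z) (\<xi> u)" if "u \<in> U" for u
    using inn_second_ff[OF that normal[OF that]] second_ff_commute[OF that, of Y Z] by simp
  then have "der (\<lambda>u. inn u (B u Y Z) (\<xi> u)) u = der (\<lambda>u. inn u (cov (\<lambda>u. der f u Y) u Z) (\<xi> u)) u"
    by (rule der_cong_open[OF open_source u])
  then have "der (\<lambda>u. inn u (B u Y Z) (\<xi> u)) u X = der (\<lambda>u. inn u (cov (\<lambda>u. der f u Y) u Z) (\<xi> u)) u X"
    by simp
  also have "\<dots> = inn u (cov (\<lambda>u. cov (\<lambda>u. der f u Y) u Z) u X) (\<xi> u) + inn u (cov (\<lambda>u. der f u Y) u Z) (cov \<xi> u X)"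
    by (rule der_inn[OF u smooth_on_differentiable[OF smooth_DY u] smooth_on_differentiable[OF \<xi> u]])
  also have "inn u (cov (\<lambda>u. der f u Y) u Z) (cov \<xi> u X) =
      inn u (B u Z Y) (cov \<xi> u X) - inn u (B u X (christoffel g u Z Y)) (\<xi> u)"
    using weingarten[OF u \<xi> normal, of X "christoffel g u Z Y"]
      inn_commute[OF u, of "cov \<xi> u X" "der f u (christoffel g u Z Y)"]
    by (simp add: second_ff_def ip_diff_left)
  finally show ?thesis
    by (simp add: cov_deriv_form_def second_ff_commute[OF u, of "christoffel g u X Y" Z])
qed

text \<open>The correction terms arise because \<open>B\<close> is contracted with a field
  \<open>\<xi>\<close> that may fail to be parallel. They contain its full ambient derivative, but
  \<open>B\<close> is normal and sees the normal part.\<close>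

lemma codazzi:
  assumes u: "u \<in> U" and \<xi>: "smooth_on U \<xi>" and normal: "\<And>u Z. u \<in> U \<Longrightarrow> inn u (\<xi> u) (der f u Z) = 0"
    and curv: "inn u (curvature h (f u) (der f u X) (der f u Z) (der f u Y)) (\<xi> u) = 0"
  shows "cov_deriv_form g (\<lambda>u X Y. inn u (B u X Y) (\<xi> u)) u X Y Z =
    cov_deriv_form g (\<lambda>u X Y. inn u (B u X Y) (\<xi> u)) u Z Y X +
    inn u (B u Z Y) (cov \<xi> u X) - inn u (B u X Y) (cov \<xi> u Z)"
proof -
  have "inn u (cov (\<lambda>u. cov (\<lambda>u. der f u Y) u Z) u X) (\<xi> u) = inn u (cov (\<lambda>u. cov (\<lambda>u. der f u Y) u X) u Z) (\<xi> u)"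
    using curv unfolding cov_cov[OF u smooth_der_map, symmetric] by (simp add: ip_diff_left)
  then show ?thesis
    by (simp add: cov_deriv_second_ff[OF u \<xi> normal] dom.christoffel_commute[OF u, of X Z])
qed

end

locale biconservative_cmc_surface = immersed_surface V h U f g
  for V :: "(real^'n) set" and h and U :: "(real^2) set" and f g +
  fixes c k :: real
  assumes curvature_target: "u \<in> U \<Longrightarrow>
      curvature h (f u) a b w = c *\<^sub>R (ip (h (f u)) b w *\<^sub>R a - ip (h (f u)) a w *\<^sub>R b)"
    and norm_mean_curvature: "u \<in> U \<Longrightarrow> norm_H g h f u = k"
    and div_free: "u \<in> U \<Longrightarrow> divergence g (stress_bienergy g h f) u Z = 0"
begin

lemma inn_mean_curvature: "u \<in> U \<Longrightarrow> inn u (H u) (H u) = k\<^sup>2"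
proof -
  assume u: "u \<in> U"
  have "inn u (H u) (H u) \<ge> 0"
    using ip_pos[OF maps_into[OF u], of "H u"] by (cases "H u = 0") (auto simp: ip_zero_left)
  then show ?thesis
    using norm_mean_curvature[OF u] by (auto simp: norm_H_def)
qed

lemma inn_mean_curvature_cov:
  assumes u: "u \<in> U"
  shows "inn u (H u) (cov H u X) = 0"
proof -
  have "der (\<lambda>u. inn u (H u) (H u)) u = der (\<lambda>u. k\<^sup>2) u"
    by (rule der_cong_open[OF open_source u]) (rule inn_mean_curvature)
  moreover have "H differentiable (at u)"
    by (rule smooth_on_differentiable[OF smooth_mean_curvature u])
  ultimately show ?thesis
    using der_inn[OF u, of H H X] inn_commute[OF u, of "cov H u X"] by simp
qed

text \<open>For constant \<open>|H|\<close> the equation \<open>div S\<^sub>2 = 0\<close> says that the trace of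
  \<open>A\<^bsub>\<nabla>\<^sup>\<bottom>H\<^esub>\<close> vanishes; the tangential part of \<open>cov H u X\<close> does not contribute.\<close>

lemma trace_shape_operator_nabla_H:
  assumes u: "u \<in> U"
  shows "trace_form (g u) (\<lambda>X Y. inn u (B u Z Y) (cov H u X)) = 0"
proof -
  define b where "b = (\<lambda>u X Y. inn u (B u X Y) (H u))"
  have smooth_b: "smooth_on U (\<lambda>u. b u X Y)" for X Y
    unfolding b_def by (rule smooth_inn[OF smooth_second_ff smooth_mean_curvature])
  note Db = has_derivative_der[OF smooth_on_differentiable[OF smooth_b u]]
  have b_commute: "b u X Y = b u Y X" if "u \<in> U" for u X Y
    unfolding b_def second_ff_commute[OF that, of X Y] ..
  have stress: "stress_bienergy g h f y X Y = - 2 * k\<^sup>2 * ip (g y) X Y + 4 * b y X Y" if "y \<in> U" for y X Y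
    using that by (simp add: stress_bienergy_def norm_mean_curvature ip_shape_operator b_def)
  \<comment> \<open>The metric term of the tensor drops out: its coefficient is constant because |H|
    is, and the metric is parallel.\<close>
  have "cov_deriv_form g (stress_bienergy g h f) u X Y Z = 4 * cov_deriv_form g b u X Y Z" for X Y Z
  proof -
    have "((\<lambda>y. - 2 * k\<^sup>2 * ip (g y) Y Z + 4 * b y Y Z) has_derivative
        (\<lambda>z. - 2 * k\<^sup>2 * (ip (der g u z) Y Z + ip (g u) 0 Z + ip (g u) Y 0) + 4 * der (\<lambda>y. b y Y Z) u z)) (at u)"
      by (intro has_derivative_add has_derivative_mult_right Db
          has_derivative_ip[OF dom.has_derivative_metric[OF u] has_derivative_const has_derivative_const])
    moreover have "der (\<lambda>y. stress_bienergy g h f y Y Z) u = der (\<lambda>y. - 2 * k\<^sup>2 * ip (g y) Y Z + 4 * b y Y Z) u"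
      by (rule der_cong_open[OF open_source u]) (rule stress)
    ultimately have "der (\<lambda>y. stress_bienergy g h f y Y Z) u X =
        - 2 * k\<^sup>2 * ip (der g u X) Y Z + 4 * der (\<lambda>y. b y Y Z) u X"
      using der_eqI by (fastforce simp: ip_linear)
    then show ?thesis
      by (simp add: cov_deriv_form_def stress[OF u] dom.metric_compatible[OF u] algebra_simps)
  qed
  then have "trace_form (g u) (\<lambda>X Y. 4 * cov_deriv_form g b u X Y Z) = 0"
    using div_free[OF u, of Z] by (simp add: divergence_def trace_form_def)
  then have "trace_form (g u) (\<lambda>X Y. cov_deriv_form g b u X Y Z) = 0"
    by (simp add: trace_form_def sum_distrib_left[symmetric] mult.left_commute)
  \<comment> \<open>Codazzi moves the differentiation from \<open>X\<close>, which is traced against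
    \<open>Y\<close>, to the free direction \<open>Z\<close>. Its curvature hypothesis holds since
    in constant curvature R(a, b)w is a combination of a and b, here tangent vectors, while
    \<open>H u\<close> is normal.\<close>
  moreover have "cov_deriv_form g b u X Y Z = cov_deriv_form g b u Z X Y +
      inn u (B u Z Y) (cov H u X) - inn u (B u X Y) (cov H u Z)" for X Y
  proof -
    have "der (\<lambda>u. b u Y X) u = der (\<lambda>u. b u X Y) u"
      by (rule der_cong_open[OF open_source u]) (rule b_commute)
    then have "cov_deriv_form g b u Z Y X = cov_deriv_form g b u Z X Y"
      using b_commute[OF u, of Y "christoffel g u Z X"] b_commute[OF u, of "christoffel g u Z Y" X]
      by (simp add: cov_deriv_form_def)
    moreover have "inn u (curvature h (f u) (der f u X) (der f u Z) (der f u Y)) (H u) = 0"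
      using mean_curvature_normal[OF u] inn_commute[OF u, of "H u"]
      by (simp add: curvature_target[OF u] ip_linear)
    ultimately show ?thesis
      using codazzi[OF u smooth_mean_curvature mean_curvature_normal, of X Z Y] by (simp add: b_def)
  qed
  ultimately have "trace_form (g u) (cov_deriv_form g b u Z) +
      trace_form (g u) (\<lambda>X Y. inn u (B u Z Y) (cov H u X)) - trace_form (g u) (\<lambda>X Y. inn u (B u X Y) (cov H u Z)) = 0"
    by (simp add: trace_form_add trace_form_diff)
  \<comment> \<open>The trace of \<open>b\<close> is 2|H|^2, a constant, and the trace commutes with
    covariant differentiation.\<close>
  moreover have "trace_form (g u) (cov_deriv_form g b u Z) = 0"
  proof -
    have "trace_form (g u) (cov_deriv_form g b u Z) = der (\<lambda>y. trace_form (g y) (b y)) u Z"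
      unfolding b_def
      by (rule dom.der_trace_form[OF u, symmetric])
         (auto intro: linear_inn_second_ff_left linear_inn_second_ff_right
            smooth_on_differentiable[OF smooth_b[unfolded b_def] u])
    also have "der (\<lambda>y. trace_form (g y) (b y)) u = der (\<lambda>y. 2 * k\<^sup>2) u"
      by (rule der_cong_open[OF open_source u]) (simp add: b_def trace_second_ff inn_mean_curvature)
    finally show ?thesis by simp
  qed
  ultimately show ?thesis
    by (simp add: trace_second_ff inn_mean_curvature_cov[OF u])
qed

end

section \<open>The adapted frame of a surface with nowhere parallel mean curvature\<close>

text \<open>A situation to be refuted: the assumptions will force \<open>U\<close> to be empty. The
  fixed direction \<open>X0\<close> makes an orthonormal normal frame available by formulas,
  smoothly on all of \<open>U\<close>.\<close>

locale nonparallel_surface = biconservative_cmc_surface V h U f g c k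
  for V :: "(real^4) set" and h and U :: "(real^2) set" and f g c k +
  fixes X0 :: "real^2"
  assumes c_nonzero: "c \<noteq> 0"
    and nonparallel: "u \<in> U \<Longrightarrow> normal_connection g h f H u X0 \<noteq> 0"
begin

definition \<nu> :: "real^2 \<Rightarrow> real^4" where
  "\<nu> u = normal_connection g h f H u X0"

definition E\<^sub>3 :: "real^2 \<Rightarrow> real^4" where
  "E\<^sub>3 u = inverse k *\<^sub>R H u"

text \<open>Since |H| is constant, \<open>\<nu>\<close> is orthogonal to \<open>H\<close>;
  normalised, it completes the frame of the normal bundle, which has rank two.\<close>

definition E\<^sub>4 :: "real^2 \<Rightarrow> real^4" where
  "E\<^sub>4 u = inverse (sqrt (inn u (\<nu> u) (\<nu> u))) *\<^sub>R \<nu> u"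

definition \<omega> :: "real^2 \<Rightarrow> real^2 \<Rightarrow> real" where
  "\<omega> u X = inn u (cov E\<^sub>3 u X) (E\<^sub>4 u)"

definition \<omega>_sharp :: "real^2 \<Rightarrow> real^2" where
  "\<omega>_sharp u = matrix_inv (g u) *v (\<chi> a. \<omega> u (axis a 1))"

definition \<omega>_norm :: "real^2 \<Rightarrow> real" where
  "\<omega>_norm u = sqrt (ip (g u) (\<omega>_sharp u) (\<omega>_sharp u))"

definition t :: "real^2 \<Rightarrow> real^2" where
  "t u = inverse (\<omega>_norm u) *\<^sub>R \<omega>_sharp u"

definition T :: "real^2 \<Rightarrow> real^4" where
  "T u = der f u (t u)"

text \<open>The metric dual of \<open>t\<close>, written with the ambient inner product so that
  \<open>der_inn\<close> expresses its derivatives through those of \<open>T\<close>.\<close>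

definition \<theta> :: "real^2 \<Rightarrow> real^2 \<Rightarrow> real" where
  "\<theta> u X = inn u (T u) (der f u X)"

text \<open>If \<open>k\<close> were zero, \<open>H\<close> would vanish on the whole open set
  \<open>U\<close>, and its normal derivative with it.\<close>

lemma k_nonzero:
  assumes "u \<in> U"
  shows "k \<noteq> 0"
proof
  assume "k = 0"
  then have H0: "H u = 0" if "u \<in> U" for u
    using inn_mean_curvature[OF that] ip_eq_zero_iff[OF maps_into[OF that]] by simp
  have "cov H u X0 = cov (\<lambda>u. 0) u X0"
    by (rule cov_cong[OF assms]) (rule H0)
  then have "normal_connection g h f H u X0 = normal_part g h f u 0"
    by (simp add: normal_connection_def cov_zero[OF assms])
  also have "\<dots> = 0"
  proof -
    have "(\<chi> a. (0 :: real)) = (0 :: real^2)" by (simp add: vec_eq_iff)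
    then show ?thesis by (simp add: normal_part_def ip_zero_left der_map_linear[OF assms])
  qed
  finally show False using nonparallel[OF assms] by simp
qed

section \<open>Smoothness, orthonormality and completeness of the adapted frame\<close>

lemma smooth_\<nu>: "smooth_on U \<nu>"
  unfolding \<nu>_def[abs_def] normal_connection_def
  by (rule smooth_normal_part[OF smooth_cov[OF smooth_mean_curvature]])

lemma \<nu>_normal: "u \<in> U \<Longrightarrow> inn u (\<nu> u) (der f u Z) = 0"
  unfolding \<nu>_def normal_connection_def by (rule normal_part_normal)

lemma \<nu>_pos: "u \<in> U \<Longrightarrow> inn u (\<nu> u) (\<nu> u) > 0"
  using nonparallel ip_pos[OF maps_into] by (simp add: \<nu>_def)

lemma inn_\<nu>:
  assumes u: "u \<in> U" and \<xi>: "\<And>Z. inn u \<xi> (der f u Z) = 0"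
  shows "inn u (\<nu> u) \<xi> = inn u (cov H u X0) \<xi>"
  unfolding \<nu>_def normal_connection_def by (rule inn_normal_part[OF u \<xi>])

lemma smooth_E\<^sub>3: "smooth_on U E\<^sub>3"
  unfolding E\<^sub>3_def[abs_def] by (rule smooth_on_scaleR[OF open_source smooth_on_const smooth_mean_curvature])

lemma smooth_E\<^sub>4: "smooth_on U E\<^sub>4"
proof -
  have "smooth_on U (\<lambda>u. sqrt (inn u (\<nu> u) (\<nu> u)))"
    by (rule smooth_on_sqrt[OF open_source \<nu>_pos smooth_inn[OF smooth_\<nu> smooth_\<nu>]])
  then have "smooth_on U (\<lambda>u. inverse (sqrt (inn u (\<nu> u) (\<nu> u))))"
    by (rule smooth_on_inverse[OF open_source, rotated]) (use \<nu>_pos in force)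
  then show ?thesis
    unfolding E\<^sub>4_def[abs_def] by (rule smooth_on_scaleR[OF open_source _ smooth_\<nu>])
qed

lemma E\<^sub>3_normal: "u \<in> U \<Longrightarrow> inn u (E\<^sub>3 u) (der f u Z) = 0"
  by (simp add: E\<^sub>3_def ip_linear mean_curvature_normal)

lemma E\<^sub>4_normal: "u \<in> U \<Longrightarrow> inn u (E\<^sub>4 u) (der f u Z) = 0"
  by (simp add: E\<^sub>4_def ip_linear \<nu>_normal)

lemma E\<^sub>3_unit: "u \<in> U \<Longrightarrow> inn u (E\<^sub>3 u) (E\<^sub>3 u) = 1"
  using k_nonzero[of u] by (simp add: E\<^sub>3_def ip_linear inn_mean_curvature power2_eq_square field_simps)

lemma E\<^sub>4_unit: "u \<in> U \<Longrightarrow> inn u (E\<^sub>4 u) (E\<^sub>4 u) = 1"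
  using \<nu>_pos[of u] real_sqrt_mult_self[of "inn u (\<nu> u) (\<nu> u)"]
  by (simp add: E\<^sub>4_def ip_linear field_simps)

lemma inn_H_E\<^sub>4:
  assumes u: "u \<in> U"
  shows "inn u (H u) (E\<^sub>4 u) = 0"
  using inn_\<nu>[OF u mean_curvature_normal[OF u]] inn_mean_curvature_cov[OF u, of X0]
    inn_commute[OF u, of "H u"]
  by (simp add: E\<^sub>4_def ip_linear)

lemma E\<^sub>3_E\<^sub>4: "u \<in> U \<Longrightarrow> inn u (E\<^sub>3 u) (E\<^sub>4 u) = 0"
  by (simp add: E\<^sub>3_def ip_linear inn_H_E\<^sub>4)

lemma cov_orthogonal:
  assumes u: "u \<in> U" and A: "smooth_on U A" and C: "smooth_on U C"
    and const: "\<And>u. u \<in> U \<Longrightarrow> inn u (A u) (C u) = r"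
  shows "inn u (cov A u X) (C u) = - inn u (A u) (cov C u X)"
proof -
  have "der (\<lambda>u. inn u (A u) (C u)) u = der (\<lambda>u. r) u"
    by (rule der_cong_open[OF open_source u]) (rule const)
  then show ?thesis
    using der_inn[OF u smooth_on_differentiable[OF A u] smooth_on_differentiable[OF C u], of X] by simp
qed

lemma cov_unit:
  assumes u: "u \<in> U" and A: "smooth_on U A" and unit: "\<And>u. u \<in> U \<Longrightarrow> inn u (A u) (A u) = 1"
  shows "inn u (cov A u X) (A u) = 0"
  using cov_orthogonal[OF u A A unit, of X] inn_commute[OF u, of "A u"] by simp

text \<open>The images of an orthonormal basis of the tangent plane, together with
  \<open>E\<^sub>3\<close> and \<open>E\<^sub>4\<close>, are four orthogonal nonzero vectors in
  dimension 4. The frame equations below are verified against tangent vectors,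
  \<open>E\<^sub>3\<close> and \<open>E\<^sub>4\<close> separately.\<close>

lemma frame_nondegenerate:
  assumes u: "u \<in> U" and tangent: "\<And>Y. inn u v (der f u Y) = inn u w (der f u Y)"
    and normal: "inn u v (E\<^sub>3 u) = inn u w (E\<^sub>3 u)" "inn u v (E\<^sub>4 u) = inn u w (E\<^sub>4 u)"
  shows "v = w"
proof -
  define p where "p = inverse (sqrt (ip (g u) (axis 1 1) (axis 1 1))) *\<^sub>R (axis 1 1 :: real^2)"
  have "ip (g u) (axis 1 1) (axis 1 1) > 0"
    by (rule dom.ip_pos[OF u]) (simp add: axis_eq_0_iff)
  then have p: "ip (g u) p p = 1"
    using real_sqrt_mult_self[of "ip (g u) (axis 1 1) (axis 1 1)"] by (simp add: p_def ip_linear field_simps)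
  obtain q where q: "ip (g u) q q = 1" "ip (g u) p q = 0"
    using dom.orthonormal_completion[OF u p] .
  let ?S = "{der f u p, der f u q, E\<^sub>3 u, E\<^sub>4 u}"
  note orth = E\<^sub>3_normal[OF u] E\<^sub>4_normal[OF u] E\<^sub>3_E\<^sub>4[OF u] E\<^sub>3_unit[OF u] E\<^sub>4_unit[OF u]
    isometric[OF u] p q dom.ip_commute[OF u, of q p]
    inn_commute[OF u, of "der f u _" "E\<^sub>3 u"] inn_commute[OF u, of "der f u _" "E\<^sub>4 u"]
    inn_commute[OF u, of "E\<^sub>4 u" "E\<^sub>3 u"]
  have distinct: "der f u p \<noteq> der f u q" "der f u p \<noteq> E\<^sub>3 u" "der f u p \<noteq> E\<^sub>4 u"
    "der f u q \<noteq> E\<^sub>3 u" "der f u q \<noteq> E\<^sub>4 u" "E\<^sub>3 u \<noteq> E\<^sub>4 u"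
    using isometric[OF u, of p p] isometric[OF u, of p q] E\<^sub>3_normal[OF u, of p] E\<^sub>4_normal[OF u, of p]
      E\<^sub>3_normal[OF u, of q] E\<^sub>4_normal[OF u, of q] E\<^sub>3_E\<^sub>4[OF u] E\<^sub>3_unit[OF u] E\<^sub>4_unit[OF u] p q
    by auto
  have "v - w = 0"
  proof (rule orthogonal_family_nondegenerate[OF maps_into[OF u], of ?S])
    show "card ?S = CARD(4)"
      using distinct by simp
    have "inn u s s = 1" if "s \<in> ?S" for s
      using that orth by auto
    then show "s \<noteq> 0" if "s \<in> ?S" for s
      using that ip_zero_left[of "h (f u)" 0] by (metis zero_neq_one)
    show "inn u r s = 0" if "r \<in> ?S" "s \<in> ?S" "r \<noteq> s" for r s
      using that by (auto simp: orth)
    show "inn u (v - w) s = 0" if "s \<in> ?S" for s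
      using that tangent normal by (auto simp: ip_diff_left)
  qed simp
  then show ?thesis by simp
qed

lemma cov_E\<^sub>3: "u \<in> U \<Longrightarrow> cov E\<^sub>3 u X = inverse k *\<^sub>R cov H u X"
  unfolding E\<^sub>3_def[abs_def]
  by (subst cov_scaleR) (auto intro: smooth_on_differentiable[OF smooth_mean_curvature])

lemma linear_\<omega>: "u \<in> U \<Longrightarrow> linear (\<omega> u)"
  unfolding \<omega>_def[abs_def]
  by (rule linear_compose[OF linear_cov linear_ip_left, unfolded o_def])
     (auto intro: smooth_on_differentiable[OF smooth_E\<^sub>3])

lemma smooth_\<omega>: "smooth_on U (\<lambda>u. \<omega> u X)"
  unfolding \<omega>_def by (rule smooth_inn[OF smooth_cov[OF smooth_E\<^sub>3] smooth_E\<^sub>4])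

text \<open>The value is the length of \<open>\<nu>\<close> divided by \<open>k\<close>. Hence the
  dual vector of \<open>\<omega>\<close> has no zeros and can be normalised to
  \<open>t\<close>.\<close>

lemma \<omega>_X0:
  assumes u: "u \<in> U"
  shows "\<omega> u X0 \<noteq> 0"
  using \<nu>_pos[OF u] k_nonzero[OF u] inn_\<nu>[OF u \<nu>_normal[OF u]]
  by (simp add: \<omega>_def cov_E\<^sub>3[OF u] E\<^sub>4_def ip_linear)

lemma ip_\<omega>_sharp:
  assumes u: "u \<in> U"
  shows "ip (g u) (\<omega>_sharp u) X = \<omega> u X"
  using linear_axis_expansion[OF linear_\<omega>[OF u], of X]
  by (simp add: \<omega>_sharp_def dom.ip_matrix_inv[OF u] inner_vec_def mult.commute)

lemma \<omega>_sharp_pos: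
  assumes u: "u \<in> U"
  shows "ip (g u) (\<omega>_sharp u) (\<omega>_sharp u) > 0"
  using ip_\<omega>_sharp[OF u, of X0] \<omega>_X0[OF u] dom.ip_pos[OF u] by (metis ip_zero_left)

lemma smooth_\<omega>_sharp: "smooth_on U \<omega>_sharp"
  unfolding \<omega>_sharp_def[abs_def]
  by (rule smooth_on_matrix_inv_apply[OF open_source dom.smooth_metric dom.invertible_metric
        smooth_on_vec_lambda[OF open_source smooth_\<omega>]])

lemma \<omega>_norm_pos: "u \<in> U \<Longrightarrow> \<omega>_norm u > 0"
  by (simp add: \<omega>_norm_def \<omega>_sharp_pos)

lemma smooth_t: "smooth_on U t"
proof -
  have "smooth_on U \<omega>_norm"
    unfolding \<omega>_norm_def[abs_def]
    by (rule smooth_on_sqrt[OF open_source \<omega>_sharp_pos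
          smooth_on_ip[OF open_source dom.smooth_metric smooth_\<omega>_sharp smooth_\<omega>_sharp]])
  then have "smooth_on U (\<lambda>u. inverse (\<omega>_norm u))"
    by (rule smooth_on_inverse[OF open_source, rotated]) (use \<omega>_norm_pos in force)
  then show ?thesis
    unfolding t_def[abs_def] by (rule smooth_on_scaleR[OF open_source _ smooth_\<omega>_sharp])
qed

lemma smooth_T: "smooth_on U T"
  unfolding T_def[abs_def] by (rule smooth_der_map_apply[OF smooth_t])

lemma \<theta>_eq: "u \<in> U \<Longrightarrow> \<theta> u X = ip (g u) (t u) X"
  by (simp add: \<theta>_def T_def isometric)

lemma \<omega>_eq: "u \<in> U \<Longrightarrow> \<omega> u X = \<omega>_norm u * \<theta> u X"
  using \<omega>_norm_pos[of u] by (simp add: \<theta>_eq t_def ip_linear ip_\<omega>_sharp)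

lemma \<theta>_t: "u \<in> U \<Longrightarrow> \<theta> u (t u) = 1"
  using \<omega>_sharp_pos[of u] real_sqrt_mult_self[of "ip (g u) (\<omega>_sharp u) (\<omega>_sharp u)"]
  by (simp add: \<theta>_eq t_def \<omega>_norm_def ip_linear field_simps)

lemma smooth_\<theta>: "smooth_on U (\<lambda>u. \<theta> u X)"
  unfolding \<theta>_def by (rule smooth_inn[OF smooth_T smooth_der_map])

lemma T_unit: "u \<in> U \<Longrightarrow> inn u (T u) (T u) = 1"
  using \<theta>_t[of u] by (simp add: \<theta>_def T_def)

lemma T_E\<^sub>3: "u \<in> U \<Longrightarrow> inn u (T u) (E\<^sub>3 u) = 0"
  using E\<^sub>3_normal[of u "t u"] inn_commute[of u "T u" "E\<^sub>3 u"] by (simp add: T_def)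

lemma T_E\<^sub>4: "u \<in> U \<Longrightarrow> inn u (T u) (E\<^sub>4 u) = 0"
  using E\<^sub>4_normal[of u "t u"] inn_commute[of u "T u" "E\<^sub>4 u"] by (simp add: T_def)

lemma E\<^sub>4_E\<^sub>3: "u \<in> U \<Longrightarrow> inn u (E\<^sub>4 u) (E\<^sub>3 u) = 0"
  using E\<^sub>3_E\<^sub>4[of u] inn_commute[of u "E\<^sub>4 u" "E\<^sub>3 u"] by simp

text \<open>The vector \<open>q\<close> spans the common kernel of the proportional forms
  \<open>\<theta>\<close> and \<open>\<omega>\<close>; in the basis t, q the later computations
  split into the direction of \<open>\<omega>\<close> and the one where it vanishes.\<close>

lemma complete_t:
  assumes u: "u \<in> U"
  obtains q where "ip (g u) (t u) (t u) = 1" "ip (g u) q q = 1" "ip (g u) (t u) q = 0"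
    "\<theta> u q = 0" "\<omega> u q = 0" "\<And>X. X = \<theta> u X *\<^sub>R t u + ip (g u) X q *\<^sub>R q"
proof -
  have t: "ip (g u) (t u) (t u) = 1" using \<theta>_t[OF u] by (simp add: \<theta>_eq[OF u])
  obtain q where q: "ip (g u) q q = 1" "ip (g u) (t u) q = 0"
    using dom.orthonormal_completion[OF u t] .
  have "X = \<theta> u X *\<^sub>R t u + ip (g u) X q *\<^sub>R q" for X
    using dom.orthonormal_expansion[OF u t q, of X] by (simp add: \<theta>_eq[OF u] dom.ip_commute[OF u, of X "t u"])
  with t q show thesis
    using that by (simp add: \<theta>_eq[OF u] \<omega>_eq[OF u])
qed

section \<open>Shape operators and derivatives of the frame\<close>

lemma curvature_normal:
  assumes "u \<in> U" "\<And>Z. inn u \<xi> (der f u Z) = 0"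
  shows "curvature h (f u) (der f u X) (der f u Y) \<xi> = 0"
  using assms(2) inn_commute[OF assms(1), of _ \<xi>] by (simp add: curvature_target[OF assms(1)])

text \<open>\<open>A\<^sub>4 = 0\<close>: the shape operator in the direction \<open>E\<^sub>4\<close> is traceless, and \<open>div S\<^sub>2 = 0\<close> puts
  \<open>t\<close> into its kernel.\<close>

lemma second_ff_E\<^sub>4:
  assumes u: "u \<in> U"
  shows "inn u (B u X Y) (E\<^sub>4 u) = 0"
proof -
  obtain q where q: "ip (g u) (t u) (t u) = 1" "ip (g u) q q = 1" "ip (g u) (t u) q = 0"
    "\<theta> u q = 0" "\<omega> u q = 0" "\<And>X. X = \<theta> u X *\<^sub>R t u + ip (g u) X q *\<^sub>R q"
    using complete_t[OF u] by metis
  define b where "b X Y = inn u (B u X Y) (E\<^sub>4 u)" for X Y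
  have lin: "linear (\<lambda>X. b X Y)" "linear (b X)" for X Y
    unfolding b_def by (rule linear_inn_second_ff_left[OF u], rule linear_inn_second_ff_right[OF u])
  \<comment> \<open>As |H| is constant, the normal part of D_X H is k \<omega>(X)
    \<open>E\<^sub>4\<close>, so the \<open>E\<^sub>3\<close> component of \<open>B\<close> does not
    enter the trace.\<close>
  have "inn u (B u Z Y) (cov H u X) = k * (\<omega> u X * b Z Y)" for X Y Z
  proof -
    have B: "B u Z Y = inn u (B u Z Y) (E\<^sub>3 u) *\<^sub>R E\<^sub>3 u + b Z Y *\<^sub>R E\<^sub>4 u"
      by (rule frame_nondegenerate[OF u])
         (simp_all add: ip_linear second_ff_normal[OF u] E\<^sub>3_normal[OF u] E\<^sub>4_normal[OF u] b_def
            E\<^sub>3_unit[OF u] E\<^sub>4_unit[OF u] E\<^sub>3_E\<^sub>4[OF u] E\<^sub>4_E\<^sub>3[OF u])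
    have "inn u (E\<^sub>3 u) (cov H u X) = 0"
      by (simp add: E\<^sub>3_def ip_linear inn_mean_curvature_cov[OF u])
    moreover have "inn u (E\<^sub>4 u) (cov H u X) = k * \<omega> u X"
      using k_nonzero[OF u] by (simp add: \<omega>_def cov_E\<^sub>3[OF u] ip_linear inn_commute[OF u, of "cov H u X"])
    ultimately show ?thesis
      by (subst B) (simp add: ip_linear)
  qed
  moreover have "linear (\<lambda>X. k * (\<omega> u X * b Z Y))" "linear (\<lambda>Y. k * (\<omega> u X * b Z Y))" for X Y Z
    by (rule linearI; simp add: linear_add[OF linear_\<omega>[OF u]] linear_cmul[OF linear_\<omega>[OF u]]
         linear_add[OF lin(2)] linear_cmul[OF lin(2)] algebra_simps)+
  \<comment> \<open>In the trace over t, q the summand at \<open>q\<close> vanishes together with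
    \<open>\<omega> u q\<close>.\<close>
  ultimately have "k * (\<omega> u (t u) * b Z (t u)) = 0" for Z
    using trace_shape_operator_nabla_H[OF u, of Z]
      dom.trace_form_orthonormal[OF u q(1-3), of "\<lambda>X Y. k * (\<omega> u X * b Z Y)"] q(5)
    by simp
  then have bt: "b Z (t u) = 0" for Z
    using k_nonzero[OF u] \<omega>_norm_pos[OF u] by (simp add: \<omega>_eq[OF u] \<theta>_t[OF u])
  have sym: "b X Y = b Y X" for X Y
    by (simp add: b_def second_ff_commute[OF u, of X Y])
  \<comment> \<open>The trace is twice the \<open>E\<^sub>4\<close> component of \<open>H\<close>,
    which is zero.\<close>
  have "b (t u) (t u) + b q q = 0"
    using dom.trace_form_orthonormal[OF u q(1-3) lin] trace_second_ff[of u "E\<^sub>4 u"]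
    by (simp add: inn_H_E\<^sub>4[OF u] b_def[abs_def])
  then have bq: "b q q = 0" using bt by simp
  have "b X q = 0" for X
    by (subst q(6)[of X]) (simp add: linear_add[OF lin(1)] linear_cmul[OF lin(1)] sym[of "t u" q] bt bq)
  then have "b X Y = 0"
    by (subst q(6)[of Y]) (simp add: linear_add[OF lin(2)] linear_cmul[OF lin(2)] bt)
  then show ?thesis by (simp add: b_def)
qed

text \<open>The tangential part is minus the shape operator in the direction
  \<open>E\<^sub>4\<close>, which vanishes; the normal components follow from
  orthonormality.\<close>

lemma cov_E\<^sub>4:
  assumes u: "u \<in> U"
  shows "cov E\<^sub>4 u X = (- \<omega> u X) *\<^sub>R E\<^sub>3 u"
proof (rule frame_nondegenerate[OF u])
  show "inn u (cov E\<^sub>4 u X) (der f u Y) = inn u ((- \<omega> u X) *\<^sub>R E\<^sub>3 u) (der f u Y)" for Y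
    using weingarten[OF u smooth_E\<^sub>4 E\<^sub>4_normal, of X Y]
    by (simp add: second_ff_E\<^sub>4[OF u] ip_linear E\<^sub>3_normal[OF u])
  show "inn u (cov E\<^sub>4 u X) (E\<^sub>3 u) = inn u ((- \<omega> u X) *\<^sub>R E\<^sub>3 u) (E\<^sub>3 u)"
    using cov_orthogonal[OF u smooth_E\<^sub>4 smooth_E\<^sub>3 E\<^sub>4_E\<^sub>3, of X] inn_commute[OF u, of "E\<^sub>4 u"]
    by (simp add: \<omega>_def ip_linear E\<^sub>3_unit[OF u])
  show "inn u (cov E\<^sub>4 u X) (E\<^sub>4 u) = inn u ((- \<omega> u X) *\<^sub>R E\<^sub>3 u) (E\<^sub>4 u)"
    using cov_unit[OF u smooth_E\<^sub>4 E\<^sub>4_unit] by (simp add: ip_linear E\<^sub>3_E\<^sub>4[OF u])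
qed

text \<open>The second covariant derivative of \<open>E\<^sub>4\<close> is symmetric in
  \<open>X\<close> and \<open>Y\<close>, since ambient curvature of tangent pairs kills normal
  vectors. Its \<open>E\<^sub>3\<close> component is -X(\<omega>(Y)), and its tangential component
  is \<omega>(Y) times the shape operator of \<open>E\<^sub>3\<close> at \<open>X\<close>.\<close>

lemma ricci_E\<^sub>4:
  assumes u: "u \<in> U"
  shows "der (\<lambda>u. \<omega> u Y) u X = der (\<lambda>u. \<omega> u X) u Y"
    and "\<omega> u Y * inn u (B u X Z) (E\<^sub>3 u) = \<omega> u X * inn u (B u Y Z) (E\<^sub>3 u)"
proof -
  have expand: "cov (\<lambda>u. cov E\<^sub>4 u Y) u X = (- der (\<lambda>u. \<omega> u Y) u X) *\<^sub>R E\<^sub>3 u + (- \<omega> u Y) *\<^sub>R cov E\<^sub>3 u X" for X Y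
  proof -
    have D: "((\<lambda>u. - \<omega> u Y) has_derivative (\<lambda>z. - der (\<lambda>u. \<omega> u Y) u z)) (at u)"
      by (rule has_derivative_minus[OF has_derivative_der[OF smooth_on_differentiable[OF smooth_\<omega> u]]])
    have "cov (\<lambda>u. cov E\<^sub>4 u Y) u X = cov (\<lambda>u. (- \<omega> u Y) *\<^sub>R E\<^sub>3 u) u X"
      by (rule cov_cong[OF u]) (rule cov_E\<^sub>4)
    also have "\<dots> = der (\<lambda>u. - \<omega> u Y) u X *\<^sub>R E\<^sub>3 u + (- \<omega> u Y) *\<^sub>R cov E\<^sub>3 u X"
      by (rule cov_scaleR[OF u differentiableI[OF D] smooth_on_differentiable[OF smooth_E\<^sub>3 u]])
    finally show ?thesis unfolding der_eqI[OF D] .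
  qed
  have eq: "cov (\<lambda>u. cov E\<^sub>4 u Y) u X = cov (\<lambda>u. cov E\<^sub>4 u X) u Y"
    using cov_cov[OF u smooth_E\<^sub>4, of Y X] curvature_normal[OF u E\<^sub>4_normal[OF u], of X Y] by simp
  have "inn u (cov (\<lambda>u. cov E\<^sub>4 u Y) u X) (E\<^sub>3 u) = - der (\<lambda>u. \<omega> u Y) u X" for X Y
    by (simp add: expand ip_linear E\<^sub>3_unit[OF u] cov_unit[OF u smooth_E\<^sub>3 E\<^sub>3_unit])
  with eq show "der (\<lambda>u. \<omega> u Y) u X = der (\<lambda>u. \<omega> u X) u Y"
    by (metis neg_equal_iff_equal)
  have "inn u (cov (\<lambda>u. cov E\<^sub>4 u Y) u X) (der f u Z) = \<omega> u Y * inn u (B u X Z) (E\<^sub>3 u)" for X Y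
    by (simp add: expand ip_linear E\<^sub>3_normal[OF u] weingarten[OF u smooth_E\<^sub>3 E\<^sub>3_normal])
  with eq show "\<omega> u Y * inn u (B u X Z) (E\<^sub>3 u) = \<omega> u X * inn u (B u Y Z) (E\<^sub>3 u)"
    by metis
qed

text \<open>Inserting \<open>t\<close> and \<open>q\<close> into the second part of
  \<open>ricci_E\<^sub>4\<close> shows that the form vanishes on \<open>q\<close>, as \<omega>(q) =
  0 and \<omega>(t) > 0. Its trace, twice the \<open>E\<^sub>3\<close> component k of
  \<open>H\<close>, then sits entirely in the entry at t, t.\<close>

lemma second_ff_E\<^sub>3:
  assumes u: "u \<in> U"
  shows "inn u (B u X Y) (E\<^sub>3 u) = 2 * k * \<theta> u X * \<theta> u Y"
proof -
  obtain q where q: "ip (g u) (t u) (t u) = 1" "ip (g u) q q = 1" "ip (g u) (t u) q = 0"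
    "\<theta> u q = 0" "\<omega> u q = 0" "\<And>X. X = \<theta> u X *\<^sub>R t u + ip (g u) X q *\<^sub>R q"
    using complete_t[OF u] by metis
  define a where "a X Y = inn u (B u X Y) (E\<^sub>3 u)" for X Y
  have lin: "linear (\<lambda>X. a X Y)" "linear (a X)" for X Y
    unfolding a_def by (rule linear_inn_second_ff_left[OF u], rule linear_inn_second_ff_right[OF u])
  have sym: "a X Y = a Y X" for X Y
    by (simp add: a_def second_ff_commute[OF u, of X Y])
  have aq: "a q Z = 0" for Z
    using ricci_E\<^sub>4(2)[OF u, of "t u" q Z] q(5) \<omega>_norm_pos[OF u]
    by (simp add: a_def \<omega>_eq[OF u, of "t u"] \<theta>_t[OF u])
  have "a (t u) (t u) = trace_form (g u) a"
    using dom.trace_form_orthonormal[OF u q(1-3) lin] aq by simp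
  also have "\<dots> = 2 * k"
    using trace_second_ff[of u "E\<^sub>3 u"] inn_mean_curvature[OF u] k_nonzero[OF u]
    by (simp add: a_def[abs_def] E\<^sub>3_def ip_linear power2_eq_square)
  finally have att: "a (t u) (t u) = 2 * k" .
  have "a X Y = \<theta> u X * a (t u) Y" for X Y
    by (subst q(6)[of X]) (simp add: linear_add[OF lin(1)] linear_cmul[OF lin(1)] aq)
  then have "a X Y = \<theta> u X * (\<theta> u Y * (2 * k))"
    using sym att by metis
  then show ?thesis by (simp add: a_def)
qed

text \<open>With \<open>cov_T\<close> and \<open>cov_E\<^sub>4\<close> this forms a Frenet system:
  curvature 2k and torsion \<omega>(t) along \<open>t\<close>, and no change along
  \<open>q\<close>.\<close>

lemma cov_E\<^sub>3_frame:
  assumes u: "u \<in> U"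
  shows "cov E\<^sub>3 u X = (- 2 * k * \<theta> u X) *\<^sub>R T u + \<omega> u X *\<^sub>R E\<^sub>4 u"
proof (rule frame_nondegenerate[OF u])
  show "inn u (cov E\<^sub>3 u X) (der f u Y) = inn u ((- 2 * k * \<theta> u X) *\<^sub>R T u + \<omega> u X *\<^sub>R E\<^sub>4 u) (der f u Y)" for Y
    by (simp add: weingarten[OF u smooth_E\<^sub>3 E\<^sub>3_normal] second_ff_E\<^sub>3[OF u] ip_linear E\<^sub>4_normal[OF u] \<theta>_def[symmetric])
  show "inn u (cov E\<^sub>3 u X) (E\<^sub>3 u) = inn u ((- 2 * k * \<theta> u X) *\<^sub>R T u + \<omega> u X *\<^sub>R E\<^sub>4 u) (E\<^sub>3 u)"
    by (simp add: cov_unit[OF u smooth_E\<^sub>3 E\<^sub>3_unit] ip_linear T_E\<^sub>3[OF u] E\<^sub>4_E\<^sub>3[OF u])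
  show "inn u (cov E\<^sub>3 u X) (E\<^sub>4 u) = inn u ((- 2 * k * \<theta> u X) *\<^sub>R T u + \<omega> u X *\<^sub>R E\<^sub>4 u) (E\<^sub>4 u)"
    by (simp add: \<omega>_def[symmetric] ip_linear T_E\<^sub>4[OF u] E\<^sub>4_unit[OF u])
qed

text \<open>In the symmetric second derivative of \<open>E\<^sub>3\<close> the terms with \<omega>
  are symmetric on their own, because \<omega> is closed. What remains concerns the derivative of
  \<theta>(Y) T. As \<open>cov T\<close> is orthogonal to the unit field \<open>T\<close>, the
  \<open>T\<close> component shows that \<theta> is closed, and the rest is the second
  claim.\<close>

lemma ricci_E\<^sub>3:
  assumes u: "u \<in> U"
  shows "der (\<lambda>u. \<theta> u Y) u X = der (\<lambda>u. \<theta> u X) u Y"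
    and "\<theta> u Y *\<^sub>R cov T u X = \<theta> u X *\<^sub>R cov T u Y"
proof -
  note D\<theta> = smooth_on_differentiable[OF smooth_\<theta> u]
  note D\<omega> = smooth_on_differentiable[OF smooth_\<omega> u]
  note DT = smooth_on_differentiable[OF smooth_T u]
  note DE = smooth_on_differentiable[OF smooth_E\<^sub>4 u]
  have expand: "cov (\<lambda>u. cov E\<^sub>3 u Y) u X =
      (- 2 * k) *\<^sub>R (der (\<lambda>u. \<theta> u Y) u X *\<^sub>R T u + \<theta> u Y *\<^sub>R cov T u X) +
      (der (\<lambda>u. \<omega> u Y) u X *\<^sub>R E\<^sub>4 u - (\<omega> u Y * \<omega> u X) *\<^sub>R E\<^sub>3 u)" for X Y
  proof -
    have D: "((\<lambda>u. - 2 * k * \<theta> u Y) has_derivative (\<lambda>z. - 2 * k * der (\<lambda>u. \<theta> u Y) u z)) (at u)"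
      by (rule has_derivative_mult_right[OF has_derivative_der[OF D\<theta>]])
    have S: "(\<lambda>u. (- 2 * k * \<theta> u Y) *\<^sub>R T u) differentiable (at u)" "(\<lambda>u. \<omega> u Y *\<^sub>R E\<^sub>4 u) differentiable (at u)"
      using has_derivative_scaleR[OF D has_derivative_der[OF DT]]
        has_derivative_scaleR[OF has_derivative_der[OF D\<omega>] has_derivative_der[OF DE]] differentiableI by blast+
    have "cov (\<lambda>u. cov E\<^sub>3 u Y) u X = cov (\<lambda>u. (- 2 * k * \<theta> u Y) *\<^sub>R T u + \<omega> u Y *\<^sub>R E\<^sub>4 u) u X"
      by (rule cov_cong[OF u]) (rule cov_E\<^sub>3_frame)
    also have "\<dots> = (- 2 * k * der (\<lambda>u. \<theta> u Y) u X) *\<^sub>R T u + (- 2 * k * \<theta> u Y) *\<^sub>R cov T u X +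
        (der (\<lambda>u. \<omega> u Y) u X *\<^sub>R E\<^sub>4 u + \<omega> u Y *\<^sub>R cov E\<^sub>4 u X)"
      unfolding cov_add[OF u S] cov_scaleR[OF u differentiableI[OF D] DT] cov_scaleR[OF u D\<omega> DE] der_eqI[OF D] ..
    finally show ?thesis
      by (simp add: cov_E\<^sub>4[OF u] scaleR_add_right)
  qed
  have "cov (\<lambda>u. cov E\<^sub>3 u Y) u X = cov (\<lambda>u. cov E\<^sub>3 u X) u Y"
    using cov_cov[OF u smooth_E\<^sub>3, of Y X] curvature_normal[OF u E\<^sub>3_normal[OF u], of X Y] by simp
  then have "(- 2 * k) *\<^sub>R (der (\<lambda>u. \<theta> u Y) u X *\<^sub>R T u + \<theta> u Y *\<^sub>R cov T u X) =
      (- 2 * k) *\<^sub>R (der (\<lambda>u. \<theta> u X) u Y *\<^sub>R T u + \<theta> u X *\<^sub>R cov T u Y)"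
    unfolding expand ricci_E\<^sub>4(1)[OF u, of Y X] mult.commute[of "\<omega> u Y"] by (simp only: add_right_cancel)
  then have eq: "der (\<lambda>u. \<theta> u Y) u X *\<^sub>R T u + \<theta> u Y *\<^sub>R cov T u X =
      der (\<lambda>u. \<theta> u X) u Y *\<^sub>R T u + \<theta> u X *\<^sub>R cov T u Y"
    unfolding scaleR_cancel_left using k_nonzero[OF u] by simp
  have "inn u (der (\<lambda>u. \<theta> u Y) u X *\<^sub>R T u + \<theta> u Y *\<^sub>R cov T u X) (T u) = der (\<lambda>u. \<theta> u Y) u X" for X Y
    by (simp add: ip_linear T_unit[OF u] cov_unit[OF u smooth_T T_unit])
  with eq show "der (\<lambda>u. \<theta> u Y) u X = der (\<lambda>u. \<theta> u X) u Y"
    by metis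
  with eq show "\<theta> u Y *\<^sub>R cov T u X = \<theta> u X *\<^sub>R cov T u Y"
    by simp
qed

text \<open>Along \<open>q\<close> the derivative vanishes by \<open>ricci_E\<^sub>3\<close>. Along
  \<open>t\<close>, its df(q) component vanishes because closedness of \<theta> makes <D_X T, df(Y)>
  symmetric, and its \<open>T\<close> component because \<open>T\<close> has unit length; the normal
  components come from the derivatives of \<open>E\<^sub>3\<close> and \<open>E\<^sub>4\<close> by
  orthogonality.\<close>

lemma cov_T:
  assumes u: "u \<in> U"
  shows "cov T u X = (2 * k * \<theta> u X) *\<^sub>R E\<^sub>3 u"
proof -
  obtain q where q: "ip (g u) (t u) (t u) = 1" "ip (g u) q q = 1" "ip (g u) (t u) q = 0"
    "\<theta> u q = 0" "\<omega> u q = 0" "\<And>X. X = \<theta> u X *\<^sub>R t u + ip (g u) X q *\<^sub>R q"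
    using complete_t[OF u] by metis
  note DT = smooth_on_differentiable[OF smooth_T u]
  have cov_T_q: "cov T u q = 0"
    using ricci_E\<^sub>3(2)[OF u, of "t u" q] by (simp add: \<theta>_t[OF u] q(4))
  have sym: "inn u (cov T u X) (der f u Y) = inn u (cov T u Y) (der f u X)" for X Y
  proof -
    have "der (\<lambda>u. \<theta> u Y) u X = inn u (cov T u X) (der f u Y) + inn u (T u) (cov (\<lambda>u. der f u Y) u X)" for X Y
      unfolding \<theta>_def by (rule der_inn[OF u DT differentiable_der_map[OF u]])
    then show ?thesis
      using ricci_E\<^sub>3(1)[OF u, of Y X] cov_der_commute[OF u, of Y X] by simp
  qed
  have "cov T u (t u) = (2 * k) *\<^sub>R E\<^sub>3 u"
  proof (rule frame_nondegenerate[OF u])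
    fix Y
    have "inn u (cov T u (t u)) (der f u q) = 0"
      using sym[of "t u" q] by (simp add: cov_T_q ip_zero_left)
    moreover have "inn u (cov T u (t u)) (der f u (t u)) = 0"
      using cov_unit[OF u smooth_T T_unit, of "t u"] by (simp add: T_def[of u])
    ultimately have "inn u (cov T u (t u)) (der f u Y) = 0"
      by (subst q(6)[of Y]) (simp add: der_map_linear[OF u] ip_linear)
    then show "inn u (cov T u (t u)) (der f u Y) = inn u ((2 * k) *\<^sub>R E\<^sub>3 u) (der f u Y)"
      by (simp add: ip_linear E\<^sub>3_normal[OF u])
  next
    show "inn u (cov T u (t u)) (E\<^sub>3 u) = inn u ((2 * k) *\<^sub>R E\<^sub>3 u) (E\<^sub>3 u)"
      using cov_orthogonal[OF u smooth_T smooth_E\<^sub>3 T_E\<^sub>3, of "t u"]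
      by (simp add: ip_linear cov_E\<^sub>3_frame[OF u] \<theta>_t[OF u] T_unit[OF u] T_E\<^sub>4[OF u] E\<^sub>3_unit[OF u])
  next
    show "inn u (cov T u (t u)) (E\<^sub>4 u) = inn u ((2 * k) *\<^sub>R E\<^sub>3 u) (E\<^sub>4 u)"
      using cov_orthogonal[OF u smooth_T smooth_E\<^sub>4 T_E\<^sub>4, of "t u"]
      by (simp add: ip_linear cov_E\<^sub>4[OF u] T_E\<^sub>3[OF u] E\<^sub>3_E\<^sub>4[OF u])
  qed
  then show ?thesis
    using linear_add[OF linear_cov[OF u DT]] linear_cmul[OF linear_cov[OF u DT]]
    by (subst q(6)[of X]) (simp add: cov_T_q)
qed

text \<open>Since \<open>\<nabla>\<^sub>X T = 2k \<theta>(X) E\<^sub>3\<close> and \<open>\<omega>\<close> is a multiple of \<open>\<theta>\<close>, the ambient curvature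
  annihilates \<open>T\<close> on tangent planes, which is only possible for \<open>c = 0\<close>.\<close>

lemma empty_domain: "u \<notin> U"
proof
  assume u: "u \<in> U"
  obtain q where q: "ip (g u) (t u) (t u) = 1" "ip (g u) q q = 1" "ip (g u) (t u) q = 0"
    "\<theta> u q = 0" "\<omega> u q = 0" "\<And>X. X = \<theta> u X *\<^sub>R t u + ip (g u) X q *\<^sub>R q"
    using complete_t[OF u] by metis
  have expand: "cov (\<lambda>u. cov T u Y) u X =
      (2 * k * der (\<lambda>u. \<theta> u Y) u X) *\<^sub>R E\<^sub>3 u + (2 * k * \<theta> u Y) *\<^sub>R cov E\<^sub>3 u X" for X Y
  proof -
    have D: "((\<lambda>u. 2 * k * \<theta> u Y) has_derivative (\<lambda>z. 2 * k * der (\<lambda>u. \<theta> u Y) u z)) (at u)"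
      by (rule has_derivative_mult_right[OF has_derivative_der[OF smooth_on_differentiable[OF smooth_\<theta> u]]])
    have "cov (\<lambda>u. cov T u Y) u X = cov (\<lambda>u. (2 * k * \<theta> u Y) *\<^sub>R E\<^sub>3 u) u X"
      by (rule cov_cong[OF u]) (rule cov_T)
    also have "\<dots> = der (\<lambda>u. 2 * k * \<theta> u Y) u X *\<^sub>R E\<^sub>3 u + (2 * k * \<theta> u Y) *\<^sub>R cov E\<^sub>3 u X"
      by (rule cov_scaleR[OF u differentiableI[OF D] smooth_on_differentiable[OF smooth_E\<^sub>3 u]])
    finally show ?thesis unfolding der_eqI[OF D] .
  qed
  \<comment> \<open>The bound variable is \<open>v\<close> because \<open>t u\<close> is a constant
    vector here, the value of the field at \<open>u\<close>. The derivatives of \<theta> cancel by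
    closedness, and the other terms vanish because \<open>q\<close> lies in the kernels of \<theta>
    and \<omega>.\<close>
  have "cov (\<lambda>v. cov T v q) u (t u) - cov (\<lambda>v. cov T v (t u)) u q = 0"
    unfolding expand using ricci_E\<^sub>3(1)[OF u, of q "t u"] q(4,5)
    by (simp add: cov_E\<^sub>3_frame[OF u])
  then have "curvature h (f u) (der f u (t u)) (der f u q) (T u) = 0"
    using cov_cov[OF u smooth_T, of q "t u"] by simp
  moreover have "inn u (der f u q) (T u) = 0" "inn u (der f u (t u)) (T u) = 1"
    using q(1,3) by (simp_all add: T_def isometric[OF u] dom.ip_commute[OF u, of q])
  \<comment> \<open>The constant-curvature formula evaluates the vanishing vector as -c
    df(q).\<close>
  ultimately have "der f u q = 0"
    using c_nonzero by (simp add: curvature_target[OF u])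
  then show False
    using isometric[OF u, of q q] q(2) by (simp add: ip_zero_left)
qed

end

section \<open>Local and global form of the theorem\<close>

lemma riemannian_metric_on_subset: "riemannian_metric_on S g \<Longrightarrow> T \<subseteq> S \<Longrightarrow> riemannian_metric_on T g"
  unfolding riemannian_metric_on_def using smooth_on_subset by blast

text \<open>All assumptions are local and restrict to the set \<open>W\<close> where the normal
  derivative of \<open>H\<close> along \<open>X\<close> is nonzero. This set is open by continuity,
  and with \<open>X\<close> in the role of \<open>X0\<close> it carries the adapted frame, so it is
  empty.\<close>

lemma mean_curvature_parallel:
  fixes V :: "(real^4) set"
  assumes "biconservative_cmc_surface V h U f g c k" and c: "c \<noteq> 0" and u: "u \<in> U"
  shows "normal_connection g h f (mean_curvature g h f) u X = 0"
proof (rule ccontr)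
  interpret biconservative_cmc_surface V h U f g c k by fact
  define F where "F v = normal_connection g h f H v X" for v
  assume ne: "normal_connection g h f H u X \<noteq> 0"
  define W where "W = U \<inter> F -` (- {0})"
  have "smooth_on U F"
    unfolding F_def[abs_def] normal_connection_def
    by (rule smooth_normal_part[OF smooth_cov[OF smooth_mean_curvature]])
  then have "open W"
    unfolding W_def by (intro continuous_open_preimage smooth_on_continuous open_source) auto
  have "W \<subseteq> U" by (auto simp: W_def)
  interpret W: nonparallel_surface V h W f g c k X
  proof
    show "smooth_on W f" using smooth_map \<open>W \<subseteq> U\<close> by (rule smooth_on_subset)
    show "riemannian_metric_on W g" using dom.metric \<open>W \<subseteq> U\<close> by (rule riemannian_metric_on_subset)
  qed (use \<open>open W\<close> \<open>W \<subseteq> U\<close> maps_into isometric curvature_target norm_mean_curvature div_free c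
       in \<open>auto simp: W_def F_def\<close>)
  show False
    using W.empty_domain[of u] u ne by (simp add: W_def F_def)
qed

section \<open>Charts and coordinate expressions of the map\<close>

lemma smooth_manifold_chart:
  assumes "smooth_manifold M" "a \<in> atlas M"
  shows "openin (mfd_top M) (fst a)" "open (snd a ` fst a)"
    and "homeomorphic_map (subtopology (mfd_top M) (fst a)) (top_of_set (snd a ` fst a)) (snd a)"
    and "inj_on (snd a) (fst a)"
proof -
  show *: "openin (mfd_top M) (fst a)" "open (snd a ` fst a)"
    and hom: "homeomorphic_map (subtopology (mfd_top M) (fst a)) (top_of_set (snd a ` fst a)) (snd a)"
    using assms by (simp_all add: smooth_manifold_def)
  have "topspace (subtopology (mfd_top M) (fst a)) = fst a"
    using openin_subset[OF *(1)] by auto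
  then show "inj_on (snd a) (fst a)"
    using homeomorphic_imp_injective_map[OF hom] by simp
qed

text \<open>The preimage of a chart domain is open by continuity of \<open>\<phi>\<close>, and the
  source chart is a homeomorphism onto an open set.\<close>

lemma open_rep_dom:
  assumes M: "smooth_manifold M" "a \<in> atlas M" and N: "smooth_manifold N" "b \<in> atlas N"
    and \<phi>: "continuous_map (mfd_top M) (mfd_top N) \<phi>"
  shows "open (rep_dom \<phi> a b)"
proof -
  note chart = smooth_manifold_chart[OF M]
  have "openin (mfd_top M) {x \<in> topspace (mfd_top M). \<phi> x \<in> fst b}"
    by (rule openin_continuous_map_preimage[OF \<phi> smooth_manifold_chart(1)[OF N]])
  then have "openin (mfd_top M) (fst a \<inter> {x \<in> topspace (mfd_top M). \<phi> x \<in> fst b})"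
    by (rule openin_Int[OF chart(1)])
  moreover have "fst a \<inter> {x \<in> topspace (mfd_top M). \<phi> x \<in> fst b} = fst a \<inter> \<phi> -` fst b"
    using openin_subset[OF chart(1)] by auto
  ultimately have "openin (subtopology (mfd_top M) (fst a)) (fst a \<inter> \<phi> -` fst b)"
    by (simp add: openin_open_subtopology[OF chart(1)])
  then have "openin (top_of_set (snd a ` fst a)) (snd a ` (fst a \<inter> \<phi> -` fst b))"
    using homeomorphic_imp_open_map[OF chart(3)] by (simp add: open_map_def)
  then show ?thesis
    unfolding rep_dom_def using chart(2) openin_open_eq by blast
qed

lemma local_rep_into:
  assumes "smooth_manifold M" "a \<in> atlas M" "u \<in> rep_dom \<phi> a b"
  shows "local_rep \<phi> a b u \<in> snd b ` fst b"
  using assms(3) smooth_manifold_chart(4)[OF assms(1,2)] by (auto simp: rep_dom_def local_rep_def)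

theorem theorem5p1:
  fixes M :: "('a, 2) riem_mfd" and N :: "('b, 4) riem_mfd" and \<phi> :: "'a \<Rightarrow> 'b" and c :: real
  assumes "riemannian_manifold M"
    and "space_form c N"
    and "c \<noteq> 0"
    and "isometric_immersion M N \<phi>"
    and "CMC M N \<phi>"
    and "biconservative M N \<phi>"
  shows "PMC M N \<phi>"
proof -
  obtain k where k: "in_all_charts M N \<phi> (\<lambda>g h f u. norm_H g h f u = k)"
    using assms(5) by (auto simp: CMC_def)
  have M: "smooth_manifold M" and N: "riemannian_manifold N" "smooth_manifold N"
    using assms(1,2) by (simp_all add: riemannian_manifold_def space_form_def)
  have \<phi>: "continuous_map (mfd_top M) (mfd_top N) \<phi>"
    using assms(4) by (simp add: isometric_immersion_def smooth_map_def)
  show ?thesis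
    unfolding PMC_def in_all_charts_def
  proof (intro ballI allI)
    fix a b u X
    assume a: "a \<in> atlas M" and b: "b \<in> atlas N" and u: "u \<in> rep_dom \<phi> a b"
    interpret tgt: metric_domain "snd b ` fst b" "coeffs N b"
      by unfold_locales
         (use smooth_manifold_chart(2)[OF N(2) b] N(1) b in \<open>auto simp: riemannian_manifold_def\<close>)
    \<comment> \<open>Each pair of charts gives an instance of the local setting with the same
      constant \<open>k\<close>; the condition on sectional curvatures enters as the full curvature
      formula through \<open>constant_curvature\<close>.\<close>
    have "biconservative_cmc_surface (snd b ` fst b) (coeffs N b) (rep_dom \<phi> a b) (local_rep \<phi> a b) (coeffs M a) c k"
    proof
      show "open (rep_dom \<phi> a b)"
        by (rule open_rep_dom[OF M a N(2) b \<phi>])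
      show "smooth_on (rep_dom \<phi> a b) (local_rep \<phi> a b)"
        using assms(4) a b by (simp add: isometric_immersion_def smooth_map_def)
      have "riemannian_metric_on (snd a ` fst a) (coeffs M a)"
        using assms(1) a by (simp add: riemannian_manifold_def)
      then show "riemannian_metric_on (rep_dom \<phi> a b) (coeffs M a)"
        by (rule riemannian_metric_on_subset) (auto simp: rep_dom_def)
      fix u assume u: "u \<in> rep_dom \<phi> a b"
      show into: "local_rep \<phi> a b u \<in> snd b ` fst b"
        by (rule local_rep_into[OF M a u])
      show "ip (coeffs N b (local_rep \<phi> a b u)) (der (local_rep \<phi> a b) u X) (der (local_rep \<phi> a b) u Y) =
          ip (coeffs M a u) X Y" for X Y
        using assms(4) a b u by (simp add: isometric_immersion_def in_all_charts_def)
      show "curvature (coeffs N b) (local_rep \<phi> a b u) v w z = c *\<^sub>R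
          (ip (coeffs N b (local_rep \<phi> a b u)) w z *\<^sub>R v - ip (coeffs N b (local_rep \<phi> a b u)) v z *\<^sub>R w)" for v w z
        by (rule tgt.constant_curvature[OF into]) (use assms(2) b into in \<open>auto simp: space_form_def\<close>)
      show "norm_H (coeffs M a) (coeffs N b) (local_rep \<phi> a b) u = k"
        using k a b u by (simp add: in_all_charts_def)
      show "divergence (coeffs M a) (stress_bienergy (coeffs M a) (coeffs N b) (local_rep \<phi> a b)) u Z = 0" for Z
        using assms(6) a b u by (simp add: biconservative_def in_all_charts_def)
    qed
    then show "normal_connection (coeffs M a) (coeffs N b) (local_rep \<phi> a b)
        (mean_curvature (coeffs M a) (coeffs N b) (local_rep \<phi> a b)) u X = 0"
      using assms(3) u by (rule mean_curvature_parallel)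
  qed
qed

end
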